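(* Let $k$ be an algebraically closed ground field of characteristic $p>0$. Let $T\to B$ be a dominant morphism of integral varieties over $k$ whose generic fibre $C=T_\eta$ is a regular geometrically integral curve over $K=k(B)$. Assume that for some $n\ge 0$ the Frobenius pullback $C^{(p^n)}|K$ is rational. Then the total space $T$ is (inseparably) uniruled. If in addition the base $B$ is rational, then $T$ is (inseparably) unirational.
   Context: $C^{(p^n)}|K$ is the $n$-th iterated Frobenius pullback of $C|K$ (base change of $C$ along the $n$-th power of the absolute Frobenius of $\operatorname{Spec}K$); its function field is $F^{p^n}\cdot K$, where $F=K(C)=k(T)$, and it is called rational if this function field is a purely transcendental extension $K(t)$ of $K$. A variety $T$ over $k$ is (inseparably) uniruled if there is a variety $Y$ over $k$ with $\dim Y=\dim T-1$ and a dominant rational map $Y\times\mathbb P^1\dashrightarrow T$ whose associated function field extension is finite and purely inseparable; it is (inseparably) unirational if there is such a dominant, finite-degree purely inseparable rational map $\mathbb P^{\dim T}\dashrightarrow T$. (Purely inseparable extensions of degree $1$ are allowed.) *)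

theory Defs
  imports "HOL-Algebra.Algebra" "HOL-Algebra.Algebraic_Closure_Type"
    "HOL-Library.Multiset" "HOL-Library.Extended_Nat"
begin

text \<open>
  Integral varieties are treated in the language of Chevalley, Zariski and Nagata (EGA I, section 8):
  an integral separated scheme \<open>V\<close> of finite type over a field \<open>k\<close> is the same thing as the set of
  its local rings \<open>O\<^bsub>V,x\<^esub>\<close>, all regarded as subrings of its function field.  Points are local
  rings, the generic point is the function field itself, and specialisation is reverse inclusion.

  The function field is a subfield of an ambient field, given by a type of class \<open>field\<close>; a base
  field is a type \<open>'k\<close> together with an embedding \<open>\<iota>\<close> of \<open>'k\<close> into the ambient field.
\<close>


section \<open>Subrings of a field\<close>

abbreviation ambient :: "'a::field ring" where
  "ambient \<equiv> ring_of_type_algebra"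

definition as_ring :: "'a::field set \<Rightarrow> 'a ring" where
  "as_ring R = ambient\<lparr>carrier := R\<rparr>"

definition field_embedding :: "('k::field \<Rightarrow> 'a::field) \<Rightarrow> bool" where
  "field_embedding \<iota> \<longleftrightarrow> \<iota> \<in> ring_hom ambient ambient"

definition adjoin_ring :: "('k::field \<Rightarrow> 'a::field) \<Rightarrow> 'a set \<Rightarrow> 'a set" where
  "adjoin_ring \<iota> S = generate_ring ambient (range \<iota> \<union> S)"

definition adjoin_field :: "('k::field \<Rightarrow> 'a::field) \<Rightarrow> 'a set \<Rightarrow> 'a set" where
  "adjoin_field \<iota> S = generate_field ambient (range \<iota> \<union> S)"

definition fraction_field :: "'a::field set \<Rightarrow> 'a set" where
  "fraction_field A = {a / s | a s. a \<in> A \<and> s \<in> A \<and> s \<noteq> 0}"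

definition localization :: "'a::field set \<Rightarrow> 'a set \<Rightarrow> 'a set" where
  "localization A P = {a / s | a s. a \<in> A \<and> s \<in> A - P}"

definition local_subring :: "'a::field set \<Rightarrow> bool" where
  "local_subring R \<longleftrightarrow> subring R ambient \<and> (\<exists>!\<mm>. maximalideal \<mm> (as_ring R))"

definition nonunits :: "'a::field set \<Rightarrow> 'a set" where
  "nonunits R = R - Units (as_ring R)"

text \<open>For local rings, \<open>nonunits\<close> is the maximal ideal.\<close>

definition dominates :: "'a::field set \<Rightarrow> 'a set \<Rightarrow> bool" where
  "dominates R S \<longleftrightarrow> S \<subseteq> R \<and> nonunits S \<subseteq> nonunits R"

definition krull_dim :: "'a::field set \<Rightarrow> enat" where
  "krull_dim R = Sup {enat n | n. \<exists>P :: nat \<Rightarrow> 'a set.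
     (\<forall>i\<le>n. primeideal (P i) (as_ring R)) \<and> (\<forall>i<n. P i \<subset> P (Suc i))}"

definition regular_local_subring :: "'a::field set \<Rightarrow> bool" where
  "regular_local_subring R \<longleftrightarrow> local_subring R \<and> noetherian_ring (as_ring R) \<and>
     (\<exists>S. finite S \<and> S \<subseteq> R \<and> enat (card S) = krull_dim R \<and> nonunits R = genideal (as_ring R) S)"


section \<open>Field extensions\<close>

text \<open>
  Monomials in the elements of \<open>S\<close> are multisets over \<open>S\<close>, and polynomials are finitely supported
  coefficient functions on monomials.
\<close>

definition alg_independent :: "('k::field \<Rightarrow> 'a::field) \<Rightarrow> 'a set \<Rightarrow> bool" where
  "alg_independent \<iota> S \<longleftrightarrow> (\<forall>c :: 'a multiset \<Rightarrow> 'k.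
     finite {m. c m \<noteq> 0} \<longrightarrow> (\<forall>m. c m \<noteq> 0 \<longrightarrow> set_mset m \<subseteq> S) \<longrightarrow>
     (\<Sum>m | c m \<noteq> 0. \<iota> (c m) * prod_mset m) = 0 \<longrightarrow> (\<forall>m. c m = 0))"

definition transcendence_basis :: "('k::field \<Rightarrow> 'a::field) \<Rightarrow> 'a set \<Rightarrow> 'a set \<Rightarrow> bool" where
  "transcendence_basis \<iota> F S \<longleftrightarrow> S \<subseteq> F \<and> alg_independent \<iota> S \<and>
     (\<forall>x\<in>F. \<not> ring.transcendental ambient (adjoin_field \<iota> S) x)"

text \<open>Only meaningful in positive characteristic.\<close>

definition purely_inseparable :: "'a::field set \<Rightarrow> 'a set \<Rightarrow> bool" where
  "purely_inseparable K E \<longleftrightarrow> K \<subseteq> E \<and> (\<forall>x\<in>E. \<exists>n. x ^ (CHAR('a) ^ n) \<in> K)"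


section \<open>Varieties\<close>

definition spec_points :: "'a::field set \<Rightarrow> 'a set set" where
  "spec_points A = {localization A P | P. primeideal P (as_ring A)}"

definition function_field :: "'a::field set set \<Rightarrow> 'a set" where
  "function_field V = Union V"

text \<open>The coordinate ring of an integral affine variety over \<open>'k\<close> with function field \<open>F\<close>.\<close>

definition coordinate_ring :: "('k::field \<Rightarrow> 'a::field) \<Rightarrow> 'a set \<Rightarrow> 'a set \<Rightarrow> bool" where
  "coordinate_ring \<iota> F A \<longleftrightarrow> (\<exists>S. finite S \<and> A = adjoin_ring \<iota> S) \<and> fraction_field A = F"

definition affine_open :: "('k::field \<Rightarrow> 'a::field) \<Rightarrow> 'a set set \<Rightarrow> 'a set \<Rightarrow> bool" where
  "affine_open \<iota> V A \<longleftrightarrow> coordinate_ring \<iota> (function_field V) A \<and> spec_points A \<subseteq> V"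

text \<open>
  The last condition is separatedness: no local ring of the function field dominates two different
  points of \<open>V\<close> (equivalently, a valuation ring has at most one centre on \<open>V\<close>).
\<close>

definition is_variety :: "('k::field \<Rightarrow> 'a::field) \<Rightarrow> 'a set set \<Rightarrow> bool" where
  "is_variety \<iota> V \<longleftrightarrow> field_embedding \<iota> \<and>
     (\<exists>\<A>. finite \<A> \<and> \<A> \<noteq> {} \<and> (\<forall>A\<in>\<A>. coordinate_ring \<iota> (function_field V) A) \<and>
        V = (\<Union>A\<in>\<A>. spec_points A)) \<and>
     (\<forall>R\<in>V. \<forall>S\<in>V. \<forall>Q. local_subring Q \<longrightarrow> Q \<subseteq> function_field V \<longrightarrow>
        dominates Q R \<longrightarrow> dominates Q S \<longrightarrow> R = S)"

text \<open>Zariski-open subsets; the affine open subsets form a basis.\<close>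

definition open_subvariety :: "('k::field \<Rightarrow> 'a::field) \<Rightarrow> 'a set set \<Rightarrow> 'a set set \<Rightarrow> bool" where
  "open_subvariety \<iota> V U \<longleftrightarrow> U \<subseteq> V \<and>
     (\<forall>R\<in>U. \<exists>A. affine_open \<iota> V A \<and> R \<in> spec_points A \<and> spec_points A \<subseteq> U)"

text \<open>The dimension of a variety is the transcendence degree of its function field.\<close>

definition variety_dim :: "('k::field \<Rightarrow> 'a::field) \<Rightarrow> 'a set set \<Rightarrow> nat" where
  "variety_dim \<iota> V = (LEAST d. \<exists>S. finite S \<and> card S = d \<and>
     transcendence_basis \<iota> (function_field V) S)"

text \<open>
  A dominant morphism \<open>V \<rightarrow> Y\<close> is determined by the embedding \<open>\<phi>\<close> of \<open>k(Y)\<close> into \<open>k(V)\<close>: by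
  separatedness the image of the point \<open>R\<close> is the only point of \<open>Y\<close> whose image under \<open>\<phi>\<close> is
  dominated by \<open>R\<close>.
\<close>

definition dominant_morphism ::
  "('k::field \<Rightarrow> 'a::field) \<Rightarrow> 'a set set \<Rightarrow> ('k \<Rightarrow> 'b::field) \<Rightarrow> 'b set set \<Rightarrow> ('b \<Rightarrow> 'a) \<Rightarrow> bool" where
  "dominant_morphism \<iota>V V \<iota>Y Y \<phi> \<longleftrightarrow> field_embedding \<phi> \<and> \<phi> \<circ> \<iota>Y = \<iota>V \<and>
     \<phi> ` function_field Y \<subseteq> function_field V \<and> (\<forall>R\<in>V. \<exists>S\<in>Y. dominates R (\<phi> ` S))"

definition dominant_rational_map ::
  "('k::field \<Rightarrow> 'a::field) \<Rightarrow> 'a set set \<Rightarrow> ('k \<Rightarrow> 'b::field) \<Rightarrow> 'b set set \<Rightarrow> ('b \<Rightarrow> 'a) \<Rightarrow> bool" where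
  "dominant_rational_map \<iota>V V \<iota>Y Y \<phi> \<longleftrightarrow>
     (\<exists>U. U \<noteq> {} \<and> open_subvariety \<iota>V V U \<and> dominant_morphism \<iota>V U \<iota>Y Y \<phi>)"

definition finite_purely_inseparable_map ::
  "('k::field \<Rightarrow> 'a::field) \<Rightarrow> 'a set set \<Rightarrow> ('k \<Rightarrow> 'b::field) \<Rightarrow> 'b set set \<Rightarrow> ('b \<Rightarrow> 'a) \<Rightarrow> bool" where
  "finite_purely_inseparable_map \<iota>V V \<iota>Y Y \<phi> \<longleftrightarrow> dominant_rational_map \<iota>V V \<iota>Y Y \<phi> \<and>
     ring.finite_dimension ambient (\<phi> ` function_field Y) (function_field V) \<and>
     purely_inseparable (\<phi> ` function_field Y) (function_field V)"


section \<open>Projective space and products with the projective line\<close>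

text \<open>
  \<open>V\<close> is a copy of projective \<open>m\<close>-space with homogeneous coordinates \<open>1 = x 0, x 1, \<dots>, x m\<close>,
  covered by its \<open>m + 1\<close> standard affine charts.
\<close>

definition projective_space :: "('k::field \<Rightarrow> 'a::field) \<Rightarrow> nat \<Rightarrow> 'a set set \<Rightarrow> bool" where
  "projective_space \<iota> m V \<longleftrightarrow> field_embedding \<iota> \<and> (\<exists>x :: nat \<Rightarrow> 'a. x 0 = 1 \<and> inj_on x {1..m} \<and>
     alg_independent \<iota> (x ` {1..m}) \<and>
     V = (\<Union>i\<in>{..m}. spec_points (adjoin_ring \<iota> {x j / x i | j. j \<le> m})))"

text \<open>\<open>P\<close> is a copy of the product of \<open>Y\<close> with the projective line, with inhomogeneous coordinate \<open>t\<close>.\<close>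

definition product_with_line :: "('k::field \<Rightarrow> 'a::field) \<Rightarrow> 'a set set \<Rightarrow> 'a set set \<Rightarrow> bool" where
  "product_with_line \<iota> Y P \<longleftrightarrow> (\<exists>t. ring.transcendental ambient (function_field Y) t \<and>
     P = (\<Union>A\<in>{A. affine_open \<iota> Y A}.
            spec_points (generate_ring ambient (A \<union> {t})) \<union>
            spec_points (generate_ring ambient (A \<union> {inverse t}))))"

text \<open>
  Up to isomorphism every finite extension of the function field of \<open>T\<close> is contained in the algebraic
  closure of the ambient field of \<open>T\<close>.  Hence, in the following two definitions, the varieties that
  are mapped to \<open>T\<close> are taken with function fields inside that algebraic closure.
\<close>

definition uniruled :: "('k::field \<Rightarrow> 'a::field) \<Rightarrow> 'a set set \<Rightarrow> bool" where
  "uniruled \<iota> T \<longleftrightarrow> (\<exists>(\<kappa> :: 'k \<Rightarrow> 'a alg_closure) Y P \<psi>.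
     is_variety \<kappa> Y \<and> variety_dim \<kappa> Y + 1 = variety_dim \<iota> T \<and>
     product_with_line \<kappa> Y P \<and> finite_purely_inseparable_map \<kappa> P \<iota> T \<psi>)"

definition unirational :: "('k::field \<Rightarrow> 'a::field) \<Rightarrow> 'a set set \<Rightarrow> bool" where
  "unirational \<iota> T \<longleftrightarrow> (\<exists>(\<kappa> :: 'k \<Rightarrow> 'a alg_closure) V \<psi>.
     projective_space \<kappa> (variety_dim \<iota> T) V \<and> finite_purely_inseparable_map \<kappa> V \<iota> T \<psi>)"

text \<open>The function field is a purely transcendental extension of transcendence degree \<open>d\<close>.\<close>

definition is_rational :: "('k::field \<Rightarrow> 'a::field) \<Rightarrow> nat \<Rightarrow> 'a set set \<Rightarrow> bool" where
  "is_rational \<iota> d V \<longleftrightarrow> (\<exists>S. finite S \<and> card S = d \<and> alg_independent \<iota> S \<and>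
     function_field V = adjoin_field \<iota> S)"


section \<open>Base change and the generic fibre\<close>

text \<open>
  The tensor product \<open>A \<otimes>\<^bsub>K\<^esub> L\<close> of a \<open>K\<close>-subalgebra \<open>A\<close> of a field (structure map \<open>\<phi>\<close>) with an
  extension field \<open>L\<close> of \<open>K\<close> (structure map \<open>\<sigma>\<close>): the monoid algebra over \<open>L\<close> of the
  multiplicative monoid of \<open>A\<close>, modulo the relations \<open>[a + b] = [a] + [b]\<close> and \<open>[c a] = c [a]\<close> for
  \<open>c\<close> in \<open>K\<close>.
\<close>

definition monoid_algebra :: "'a::field set \<Rightarrow> ('a \<Rightarrow> 'l::field) ring" where
  "monoid_algebra A =
     \<lparr> carrier = {u. finite {a. u a \<noteq> 0} \<and> {a. u a \<noteq> 0} \<subseteq> A},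
       monoid.mult = (\<lambda>u v c. \<Sum>a | u a \<noteq> 0. \<Sum>b | v b \<noteq> 0. if a * b = c then u a * v b else 0),
       one = (\<lambda>a. if a = 1 then 1 else 0),
       ring.zero = (\<lambda>_. 0),
       add = (\<lambda>u v a. u a + v a) \<rparr>"

definition basis_elem :: "'a::field \<Rightarrow> 'a \<Rightarrow> 'l::field" where
  "basis_elem a = (\<lambda>x. if x = a then 1 else 0)"

definition tensor_relations ::
  "('K::field \<Rightarrow> 'a::field) \<Rightarrow> ('K \<Rightarrow> 'l::field) \<Rightarrow> 'a set \<Rightarrow> ('a \<Rightarrow> 'l) set" where
  "tensor_relations \<phi> \<sigma> A =
     {(\<lambda>x. basis_elem (a + b) x - basis_elem a x - basis_elem b x) | a b. a \<in> A \<and> b \<in> A} \<union>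
     {(\<lambda>x. basis_elem (\<phi> c * a) x - \<sigma> c * basis_elem a x) | c a. a \<in> A}"

definition tensor_product ::
  "('K::field \<Rightarrow> 'a::field) \<Rightarrow> ('K \<Rightarrow> 'l::field) \<Rightarrow> 'a set \<Rightarrow> ('a \<Rightarrow> 'l) set ring" where
  "tensor_product \<phi> \<sigma> A =
     monoid_algebra A Quot genideal (monoid_algebra A) (tensor_relations \<phi> \<sigma> A)"

text \<open>
  The base change of \<open>C\<close> to an algebraic closure of \<open>K\<close> is integral, i.e. the spectra of the rings
  below, which are open in the base change and cover it, are integral.  (Any two of them meet, since
  two nonempty open subsets of \<open>C\<close> do, so their union is irreducible.)
\<close>

definition geometrically_integral :: "('K::field \<Rightarrow> 'a::field) \<Rightarrow> 'a set set \<Rightarrow> bool" where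
  "geometrically_integral \<phi> C \<longleftrightarrow>
     (\<forall>A. affine_open \<phi> C A \<longrightarrow> domain (tensor_product \<phi> (to_ac :: 'K \<Rightarrow> 'K alg_closure) A))"

definition is_curve :: "('K::field \<Rightarrow> 'a::field) \<Rightarrow> 'a set set \<Rightarrow> bool" where
  "is_curve \<phi> C \<longleftrightarrow> is_variety \<phi> C \<and> variety_dim \<phi> C = 1"

definition is_regular :: "'a::field set set \<Rightarrow> bool" where
  "is_regular C \<longleftrightarrow> (\<forall>R\<in>C. regular_local_subring R)"

text \<open>
  The points of \<open>T\<close> over the generic point of \<open>B\<close>.  The generic fibre has the same local rings as \<open>T\<close>
  at these points, because \<open>O\<^bsub>T,x\<^esub> \<otimes>\<^bsub>O\<^bsub>B,\<eta>\<^esub>\<^esub> k(B) = O\<^bsub>T,x\<^esub>\<close> as \<open>O\<^bsub>B,\<eta>\<^esub> = k(B)\<close>.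
\<close>

definition generic_fibre ::
  "'a::field set set \<Rightarrow> 'b::field set set \<Rightarrow> ('b \<Rightarrow> 'a) \<Rightarrow> 'a set set" where
  "generic_fibre T B \<phi> = {R \<in> T. dominates R (\<phi> ` function_field B)}"

text \<open>
  Base change of the geometrically integral curve \<open>C\<close> over \<open>K\<close> along the Frobenius power
  \<open>x \<mapsto> x\<^sup>q\<close> of \<open>K\<close>, where \<open>q\<close> is a power of the characteristic.  Since this base change is a
  homeomorphism, there is one local ring \<open>R \<otimes>\<^bsub>K\<^esub> K\<close> for each point \<open>R\<close> of \<open>C\<close>, and
  \<open>r \<otimes> c \<mapsto> r\<^sup>q c\<close> identifies it with the subring of the function field \<open>F\<close> of \<open>C\<close> generated by
  \<open>K\<close> and the \<open>q\<close>-th powers of elements of \<open>R\<close>.  At the generic point this gives \<open>F\<^sup>q \<cdot> K\<close>.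
\<close>

definition frobenius_pullback ::
  "('K::field \<Rightarrow> 'a::field) \<Rightarrow> nat \<Rightarrow> 'a set set \<Rightarrow> 'a set set" where
  "frobenius_pullback \<phi> q C = (\<lambda>R. adjoin_ring \<phi> ((\<lambda>r. r ^ q) ` R)) ` C"

end

theory Submission
  imports Defs
begin

text \<open>
  Write \<open>F\<close> for the function field of \<open>T\<close>, \<open>K \<subseteq> F\<close> for that of \<open>B\<close>, and \<open>q = p\<^sup>n\<close>.  Rationality of
  the Frobenius pullback means \<open>F\<^sup>q \<cdot> K = K(s)\<close> with \<open>s\<close> transcendental over \<open>K\<close>; in particular
  \<open>F\<^sup>q \<subseteq> K(s)\<close>.  Taking \<open>q\<close>-th roots inside an algebraic closure of \<open>F\<close> gives \<open>F \<subseteq> E\<close>, where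
  \<open>E = K(s)\<^bsup>1/q\<^esup> = K\<^bsup>1/q\<^esup>(s\<^bsup>1/q\<^esup>)\<close>.  Everything follows from this inclusion.

  \<^item> The extension \<open>E|F\<close> is purely inseparable because \<open>E\<^sup>q = K(s) \<subseteq> F\<close>, and it is finite because \<open>E\<close> is
    generated over \<open>k\<close> by finitely many elements, each algebraic over \<open>F\<close>.

  \<^item> Extraction of \<open>q\<close>-th roots is a field embedding \<open>G\<close> of \<open>F\<close> into its algebraic closure.  It maps
    \<open>k\<close> onto itself, as \<open>k\<close> is perfect, so \<open>K\<^bsup>1/q\<^esup> = G(K)\<close> is again a finitely generated field over
    \<open>k\<close>.  It is therefore the function field of an affine variety \<open>Y\<close>, and \<open>E = G(K)(G(s))\<close>
    is the function field of \<open>Y \<times> \<P>\<^sup>1\<close>.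

  \<^item> If \<open>K\<close> is purely transcendental over \<open>k\<close>, then so are \<open>G(K)\<close> and \<open>E\<close>, and \<open>E\<close> is the function field
    of a projective space.

  \<^item> Finally \<open>E\<close> is algebraic over \<open>F\<close>, so \<open>dim Y + 1 = dim T\<close>.  Since the dimension of a variety is
    defined as the least size of a transcendence basis, this needs that all finite transcendence bases
    have the same size: \<open>alg_independent_card_le\<close>, Steinitz's exchange argument.

  An inclusion of function fields \<open>F \<subseteq> k(V)\<close> comes from a dominant rational map \<open>V \<rightarrow> T\<close>
  (\<open>dominant_rational_map_field_inclusion\<close>): the coordinates on an affine chart of \<open>T\<close> become regular
  after a common denominator is inverted on an affine chart of \<open>V\<close>.  The criteria \<open>uniruledI\<close> and
  \<open>unirationalI\<close> combine this with the function fields of \<open>Y \<times> \<P>\<^sup>1\<close> and of projective space, and so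
  reduce the theorem to the field theory above.
\<close>

section \<open>Subrings and subfields of the ambient field\<close>

lemma ambient_simps [simp]:
  "carrier (ambient :: 'a::field ring) = UNIV" "x \<otimes>\<^bsub>ambient\<^esub> y = x * y"
  "\<one>\<^bsub>ambient\<^esub> = 1" "\<zero>\<^bsub>ambient\<^esub> = 0" "x \<oplus>\<^bsub>ambient\<^esub> y = x + y"
  by (simp_all add: ring_of_type_algebra_def)

lemma field_ambient: "field (ambient :: 'a::field ring)"
  by (rule field_from_type_algebra)

lemma domain_ambient: "domain (ambient :: 'a::field ring)"
  using field_ambient by (rule field.axioms)

lemma ring_ambient: "ring (ambient :: 'a::field ring)"
  by (rule ring_from_type_algebra)

lemma a_inv_ambient [simp]: "\<ominus>\<^bsub>ambient\<^esub> (x :: 'a::field) = - x"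
proof -
  interpret field "ambient :: 'a ring" by (rule field_ambient)
  show ?thesis by (rule sum_zero_eq_neg[symmetric]) auto
qed

lemma m_inv_ambient: "(x :: 'a::field) \<noteq> 0 \<Longrightarrow> inv\<^bsub>ambient\<^esub> x = inverse x"
proof -
  assume "x \<noteq> 0"
  interpret field "ambient :: 'a ring" by (rule field_ambient)
  show ?thesis by (rule inv_unique'[symmetric]) (use \<open>x \<noteq> 0\<close> in auto)
qed

text \<open>
  The next two characterisations replace the carrier-based notions by closure under the type class
  operations; \<open>inverse 0 = 0\<close> makes a separate treatment of zero unnecessary.
\<close>

lemma subring_ambient_iff:
  "subring R (ambient :: 'a::field ring) \<longleftrightarrow>
     1 \<in> R \<and> (\<forall>x\<in>R. - x \<in> R) \<and> (\<forall>x\<in>R. \<forall>y\<in>R. x + y \<in> R) \<and> (\<forall>x\<in>R. \<forall>y\<in>R. x * y \<in> R)"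
  using ring.subringI[OF ring_ambient, of R] subringE[of R "ambient :: 'a ring"] by auto

lemma subfield_ambient_iff:
  "subfield R (ambient :: 'a::field ring) \<longleftrightarrow> subring R ambient \<and> (\<forall>x\<in>R. inverse x \<in> R)"
proof
  assume R: "subfield R (ambient :: 'a ring)"
  hence s: "subring R ambient" by (rule subfieldE)
  have "inverse x \<in> R" if "x \<in> R" for x
  proof (cases "x = 0")
    case False
    hence "inv\<^bsub>ambient\<^esub> x \<in> R"
      using ring.subfield_m_inv(1)[OF ring_ambient R, of x] that by auto
    thus ?thesis using m_inv_ambient[OF False] by simp
  qed (use that in simp)
  thus "subring R ambient \<and> (\<forall>x\<in>R. inverse x \<in> R)" using s by blast
next
  assume R: "subring R (ambient :: 'a ring) \<and> (\<forall>x\<in>R. inverse x \<in> R)"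
  show "subfield R (ambient :: 'a ring)"
    by (rule field.subfieldI'[OF field_ambient]) (use R in \<open>auto simp: m_inv_ambient\<close>)
qed

lemma subring_rules:
  assumes "subring R (ambient :: 'a::field ring)"
  shows "1 \<in> R" "0 \<in> R" "x \<in> R \<Longrightarrow> - x \<in> R" "x \<in> R \<Longrightarrow> y \<in> R \<Longrightarrow> x + y \<in> R"
    "x \<in> R \<Longrightarrow> y \<in> R \<Longrightarrow> x - y \<in> R" "x \<in> R \<Longrightarrow> y \<in> R \<Longrightarrow> x * y \<in> R" "x \<in> R \<Longrightarrow> x ^ n \<in> R"
proof -
  note R = assms[unfolded subring_ambient_iff]
  show *: "1 \<in> R" "x \<in> R \<Longrightarrow> - x \<in> R" "x \<in> R \<Longrightarrow> y \<in> R \<Longrightarrow> x + y \<in> R"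
    "x \<in> R \<Longrightarrow> y \<in> R \<Longrightarrow> x * y \<in> R" using R by auto
  have "1 + (- 1) \<in> R" using R by blast
  thus "0 \<in> R" by simp
  show "x - y \<in> R" if "x \<in> R" "y \<in> R"
  proof -
    have "x + (- y) \<in> R" using R that by blast
    thus ?thesis by simp
  qed
  show "x ^ n \<in> R" if "x \<in> R" using R that by (induction n) auto
qed

lemma subring_sum:
  assumes "subring R (ambient :: 'a::field ring)" "\<And>i. i \<in> I \<Longrightarrow> f i \<in> R"
  shows "sum f I \<in> R"
  using assms(2)
  by (induction I rule: infinite_finite_induct) (auto intro: subring_rules[OF assms(1)])

lemma subfield_divide:
  assumes "subfield R (ambient :: 'a::field ring)" "x \<in> R" "y \<in> R"
  shows "x / y \<in> R"
  using assms by (auto simp: subfield_ambient_iff subring_ambient_iff divide_inverse)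

abbreviation ring_closure :: "'a::field set \<Rightarrow> 'a set" where
  "ring_closure \<equiv> generate_ring ambient"

abbreviation field_closure :: "'a::field set \<Rightarrow> 'a set" where
  "field_closure \<equiv> generate_field ambient"

lemma subring_ring_closure: "subring (ring_closure H) (ambient :: 'a::field ring)"
  by (rule ring.generate_ring_is_subring[OF ring_ambient]) simp

lemma subfield_field_closure: "subfield (field_closure H) (ambient :: 'a::field ring)"
  by (rule field.generate_field_is_subfield[OF field_ambient]) simp

lemma subring_field_closure: "subring (field_closure H) (ambient :: 'a::field ring)"
  using subfield_field_closure by (rule subfieldE)

lemma ring_closure_least:
  "subring E (ambient :: 'a::field ring) \<Longrightarrow> H \<subseteq> E \<Longrightarrow> ring_closure H \<subseteq> E"
  by (rule ring.generate_ring_min_subring1[OF ring_ambient]) auto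

lemma field_closure_least:
  "subfield E (ambient :: 'a::field ring) \<Longrightarrow> H \<subseteq> E \<Longrightarrow> field_closure H \<subseteq> E"
  by (rule field.generate_field_min_subfield1[OF field_ambient]) auto

lemma ring_closure_superset: "H \<subseteq> ring_closure H"
  by (auto intro: generate_ring.incl)

lemma field_closure_superset: "H \<subseteq> field_closure H"
  by (auto intro: generate_field.incl)

lemma ring_closure_mono: "H \<subseteq> H' \<Longrightarrow> ring_closure H \<subseteq> ring_closure H'"
  using ring_closure_least[OF subring_ring_closure] ring_closure_superset by blast

lemma field_closure_mono: "H \<subseteq> H' \<Longrightarrow> field_closure H \<subseteq> field_closure H'"
  using field_closure_least[OF subfield_field_closure] field_closure_superset by blast

lemma field_closure_eqI:
  assumes "H \<subseteq> field_closure H'" "H' \<subseteq> field_closure H"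
  shows "field_closure H = field_closure (H' :: 'a::field set)"
  using field_closure_least[OF subfield_field_closure assms(1)]
    field_closure_least[OF subfield_field_closure assms(2)] by blast

lemma field_closure_subfield:
  "subfield K (ambient :: 'a::field ring) \<Longrightarrow> field_closure K = K"
  using field_closure_least[of K K] field_closure_superset[of K] by blast

lemma subfield_UNIV: "subfield UNIV (ambient :: 'a::field ring)"
  by (simp add: subfield_ambient_iff subring_ambient_iff)

text \<open>
  Sums, products and inverses of fractions are fractions, so the fractions with numerator and
  denominator in the generated ring form a field containing the generators.  This turns every statement
  about function fields of affine charts into one about generated fields.
\<close>

lemma fraction_field_ring_closure:
  "fraction_field (ring_closure H) = field_closure (H :: 'a::field set)"
proof
  note sr = subring_ring_closure[of H] and rules = subring_rules[OF subring_ring_closure[of H]]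
  have "ring_closure H \<subseteq> field_closure H"
    by (rule ring_closure_least[OF subring_field_closure field_closure_superset])
  thus "fraction_field (ring_closure H) \<subseteq> field_closure H"
    by (auto simp: fraction_field_def intro: subfield_divide[OF subfield_field_closure])
  have "subfield (fraction_field (ring_closure H)) ambient"
    unfolding subfield_ambient_iff subring_ambient_iff
  proof (intro conjI ballI)
    show "1 \<in> fraction_field (ring_closure H)"
      unfolding fraction_field_def using rules(1) by (auto intro!: exI[of _ 1])
  next
    fix x assume "x \<in> fraction_field (ring_closure H)"
    then obtain a s where x: "x = a / s" "a \<in> ring_closure H" "s \<in> ring_closure H" "s \<noteq> 0"
      by (auto simp: fraction_field_def)
    show "- x \<in> fraction_field (ring_closure H)"
      unfolding fraction_field_def mem_Collect_eq using x rules(3)[of a]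
      by (intro exI[of _ "- a"] exI[of _ s]) simp
    show "inverse x \<in> fraction_field (ring_closure H)"
    proof (cases "a = 0")
      case True
      thus ?thesis
        unfolding fraction_field_def mem_Collect_eq using x rules(1,2)
        by (intro exI[of _ 0] exI[of _ 1]) simp
    next
      case False
      thus ?thesis
        unfolding fraction_field_def mem_Collect_eq using x
        by (intro exI[of _ s] exI[of _ a]) simp
    qed
    fix y assume "y \<in> fraction_field (ring_closure H)"
    then obtain b u where y: "y = b / u" "b \<in> ring_closure H" "u \<in> ring_closure H" "u \<noteq> 0"
      by (auto simp: fraction_field_def)
    have "x + y = (a * u + b * s) / (s * u)" using x y by (simp add: field_simps)
    thus "x + y \<in> fraction_field (ring_closure H)"
      unfolding fraction_field_def using x y by (force intro: rules)
    have "x * y = (a * b) / (s * u)" using x y by simp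
    thus "x * y \<in> fraction_field (ring_closure H)"
      unfolding fraction_field_def using x y by (force intro: rules)
  qed
  moreover have "H \<subseteq> fraction_field (ring_closure H)"
    unfolding fraction_field_def using ring_closure_superset[of H] rules(1) by force
  ultimately show "field_closure H \<subseteq> fraction_field (ring_closure H)"
    by (rule field_closure_least)
qed

lemma ring_closure_subring: "subring A (ambient :: 'a::field ring) \<Longrightarrow> ring_closure A = A"
  using ring_closure_least[of A A] ring_closure_superset[of A] by blast

lemma fraction_field_subring:
  "subring A (ambient :: 'a::field ring) \<Longrightarrow> fraction_field A = field_closure A"
  using fraction_field_ring_closure[of A] by (simp add: ring_closure_subring)

lemma common_denominator:
  assumes A: "subring A (ambient :: 'a::field ring)" and "finite Z" "Z \<subseteq> fraction_field A"
  shows "\<exists>h\<in>A. h \<noteq> 0 \<and> (\<forall>x\<in>Z. h * x \<in> A)"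
  using assms(2,3)
proof (induction Z rule: finite_induct)
  case empty
  show ?case using subring_rules(1)[OF A] by (intro bexI[of _ 1]) auto
next
  case (insert x Z)
  then obtain h where h: "h \<in> A" "h \<noteq> 0" "\<And>y. y \<in> Z \<Longrightarrow> h * y \<in> A" by auto
  obtain a s where x: "x = a / s" "a \<in> A" "s \<in> A" "s \<noteq> 0"
    using insert.prems by (auto simp: fraction_field_def)
  have "h * s * y \<in> A" if "y \<in> insert x Z" for y
  proof (cases "y = x")
    case True
    hence eq: "h * s * y = h * a" using x by simp
    show ?thesis unfolding eq by (rule subring_rules(6)[OF A h(1) x(2)])
  next
    case False
    hence "s * (h * y) \<in> A" using that h x subring_rules(6)[OF A] by simp
    thus ?thesis by (simp add: mult_ac)
  qed
  thus ?case using h x subring_rules(6)[OF A] by (intro bexI[of _ "h * s"]) auto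
qed

section \<open>Field embeddings\<close>

lemma field_embedding_iff:
  "field_embedding f \<longleftrightarrow> f 1 = 1 \<and> (\<forall>x y. f (x + y) = f x + f y) \<and> (\<forall>x y. f (x * y) = f x * f y)"
  by (auto simp: field_embedding_def ring_hom_def)

context
  fixes f :: "'a::field \<Rightarrow> 'b::field"
  assumes f: "field_embedding f"
begin

lemma emb_1: "f 1 = 1" and emb_add: "f (x + y) = f x + f y" and emb_mult: "f (x * y) = f x * f y"
  using f by (auto simp: field_embedding_iff)

lemma emb_0: "f 0 = 0"
  using emb_add[of 0 0] by (metis add_cancel_right_right add_0)

lemma emb_minus: "f (- x) = - f x"
  using emb_add[of x "- x"] emb_0 by (simp add: eq_neg_iff_add_eq_0 add.commute)

lemma emb_eq_0_iff: "f x = 0 \<longleftrightarrow> x = 0"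
proof
  assume "f x = 0"
  show "x = 0"
  proof (rule ccontr)
    assume "x \<noteq> 0"
    hence "f (x * inverse x) = 1" by (simp add: emb_1)
    thus False using \<open>f x = 0\<close> by (simp add: emb_mult del: right_inverse)
  qed
qed (simp add: emb_0)

lemma emb_inj: "inj f"
proof (rule injI)
  fix x y assume "f x = f y"
  hence "f (x + - y) = 0" unfolding emb_add emb_minus by simp
  thus "x = y" using emb_eq_0_iff by simp
qed

lemma emb_inverse: "f (inverse x) = inverse (f x)"
proof (cases "x = 0")
  case False
  hence "f x * f (inverse x) = 1" using emb_mult[of x "inverse x"] by (simp add: emb_1)
  thus ?thesis by (metis inverse_unique)
qed (simp add: emb_0)

lemma emb_divide: "f (x / y) = f x / f y"
  by (simp add: divide_inverse emb_mult emb_inverse)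

lemma emb_power: "f (x ^ n) = f x ^ n"
  by (induction n) (auto simp: emb_1 emb_mult)

lemma emb_sum: "f (sum g I) = (\<Sum>i\<in>I. f (g i))"
  by (induction I rule: infinite_finite_induct) (auto simp: emb_0 emb_add)

lemma emb_subring: "subring R ambient \<Longrightarrow> subring (f ` R) ambient"
  unfolding subring_ambient_iff
  by (auto simp flip: emb_add emb_mult emb_minus intro: image_eqI[of _ f, OF emb_1[symmetric]])

lemma emb_subfield: "subfield R ambient \<Longrightarrow> subfield (f ` R) ambient"
  unfolding subfield_ambient_iff using emb_subring by (auto simp flip: emb_inverse)

lemma emb_subring_vimage: "subring R ambient \<Longrightarrow> subring (f -` R) ambient"
  unfolding subring_ambient_iff by (auto simp: emb_add emb_mult emb_minus emb_1)

lemma emb_subfield_vimage: "subfield R ambient \<Longrightarrow> subfield (f -` R) ambient"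
  unfolding subfield_ambient_iff using emb_subring_vimage by (auto simp: emb_inverse)

lemma emb_field_closure: "f ` field_closure H = field_closure (f ` H)"
proof
  have "field_closure H \<subseteq> f -` field_closure (f ` H)"
    by (rule field_closure_least) (use emb_subfield_vimage[OF subfield_field_closure] 
        field_closure_superset[of "f ` H"] in auto)
  thus "f ` field_closure H \<subseteq> field_closure (f ` H)" by blast
  show "field_closure (f ` H) \<subseteq> f ` field_closure H"
    by (rule field_closure_least) (use emb_subfield[OF subfield_field_closure] 
        field_closure_superset[of H] in auto)
qed

lemma emb_char: "CHAR('b) = CHAR('a)"
proof (rule CHAR_eqI)
  have of_nat: "f (of_nat n) = of_nat n" for n
    by (induction n) (simp_all add: emb_0 emb_1 emb_add)
  show "of_nat CHAR('a) = (0 :: 'b)"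
    using of_nat[of "CHAR('a)"] by (simp add: emb_0)
  fix n assume "of_nat n = (0 :: 'b)"
  hence "f (of_nat n) = 0" by (simp add: of_nat)
  thus "CHAR('a) dvd n" by (simp add: emb_eq_0_iff of_nat_eq_0_iff_char_dvd)
qed

end

lemma field_embedding_comp:
  "field_embedding f \<Longrightarrow> field_embedding g \<Longrightarrow> field_embedding (g \<circ> f)"
  by (simp add: field_embedding_iff)

lemma field_embedding_to_ac: "field_embedding (to_ac :: 'a::field \<Rightarrow> 'a alg_closure)"
  by (simp add: field_embedding_iff)

section \<open>Points of an affine variety\<close>

lemma primeideal_as_ring_iff:
  assumes A: "subring A (ambient :: 'a::field ring)"
  shows "primeideal P (as_ring A) \<longleftrightarrow> P \<subseteq> A \<and> 0 \<in> P \<and> (\<forall>x\<in>P. \<forall>y\<in>P. x + y \<in> P) \<and>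
    (\<forall>a\<in>A. \<forall>x\<in>P. a * x \<in> P) \<and> 1 \<notin> P \<and> (\<forall>a\<in>A. \<forall>b\<in>A. a * b \<in> P \<longrightarrow> a \<in> P \<or> b \<in> P)"
    (is "_ \<longleftrightarrow> ?R")
proof -
  note rules = subring_rules[OF A]
  interpret A: cring "as_ring A"
  proof -
    interpret domain "ambient :: 'a ring" by (rule domain_ambient)
    show "cring (as_ring A)" unfolding as_ring_def
      using subring_is_domain[OF A] by (rule domain.axioms)
  qed
  have [simp]: "carrier (as_ring A) = A" "\<And>x y. x \<otimes>\<^bsub>as_ring A\<^esub> y = x * y"
    "\<one>\<^bsub>as_ring A\<^esub> = 1" "\<zero>\<^bsub>as_ring A\<^esub> = 0" "\<And>x y. x \<oplus>\<^bsub>as_ring A\<^esub> y = x + y"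
    by (simp_all add: as_ring_def)
  show ?thesis
  proof
    assume "primeideal P (as_ring A)"
    then interpret P: primeideal P "as_ring A" .
    have "1 \<notin> P" using P.one_imp_carrier P.I_notcarr by auto
    thus ?R using P.Icarr P.I_prime P.I_l_closed
        additive_subgroup.a_closed[OF P.additive_subgroup_axioms] 
        additive_subgroup.zero_closed[OF P.additive_subgroup_axioms] by auto
  next
    assume R: ?R
    have neg: "\<ominus>\<^bsub>as_ring A\<^esub> x = - x" if "x \<in> A" for x
      using that rules(3)[OF that] by (intro A.sum_zero_eq_neg[symmetric]) auto
    have negP: "- x \<in> P" if "x \<in> P" for x
    proof -
      have "(- 1) * x \<in> P" using R that rules(1,3) by blast
      thus ?thesis by simp
    qed
    have "ideal P (as_ring A)"
    proof (rule idealI[OF A.ring_axioms])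
      show "subgroup P (add_monoid (as_ring A))"
      proof (rule group.subgroupI[OF A.add.group_axioms])
        fix x assume "x \<in> P"
        hence "\<ominus>\<^bsub>as_ring A\<^esub> x \<in> P" using R negP neg by auto
        thus "inv\<^bsub>add_monoid (as_ring A)\<^esub> x \<in> P" unfolding a_inv_def .
      qed (use R in auto)
      show "\<And>a x. a \<in> P \<Longrightarrow> x \<in> carrier (as_ring A) \<Longrightarrow> x \<otimes>\<^bsub>as_ring A\<^esub> a \<in> P" using R by auto
      show "\<And>a x. a \<in> P \<Longrightarrow> x \<in> carrier (as_ring A) \<Longrightarrow> a \<otimes>\<^bsub>as_ring A\<^esub> x \<in> P"
        using R by (metis ambient_simps(2) mult.commute \<open>\<And>x y. x \<otimes>\<^bsub>as_ring A\<^esub> y = x * y\<close> \<open>carrier (as_ring A) = A\<close>)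
    qed
    thus "primeideal P (as_ring A)"
      by (rule primeidealI[OF _ A.cring_axioms]) (use R rules(1) in auto)
  qed
qed

lemma nonunits_iff: "x \<in> nonunits R \<longleftrightarrow> x \<in> R \<and> (\<forall>y\<in>R. x * y \<noteq> 1)"
  unfolding nonunits_def Units_def as_ring_def by (auto simp: mult.commute)

text \<open>
  These are the elements of the maximal ideal.  If \<open>a\<close> is in \<open>P\<close> and \<open>a / s\<close> had an inverse \<open>b / u\<close>, then
  \<open>s * u = a * b\<close> would be in \<open>P\<close>, but neither \<open>s\<close> nor \<open>u\<close> is.
\<close>

lemma localization_nonunits_iff:
  assumes A: "subring A (ambient :: 'a::field ring)" and P: "primeideal P (as_ring A)"
    and "a \<in> A" "s \<in> A" "s \<notin> P"
  shows "a / s \<in> nonunits (localization A P) \<longleftrightarrow> a \<in> P"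
proof -
  note P' = P[unfolded primeideal_as_ring_iff[OF A]]
  have s0: "s \<noteq> 0" using assms P' by auto
  have in_loc: "a / s \<in> localization A P" using assms by (auto simp: localization_def)
  show ?thesis
  proof
    assume nu: "a / s \<in> nonunits (localization A P)"
    show "a \<in> P"
    proof (rule ccontr)
      assume "a \<notin> P"
      hence "s / a \<in> localization A P" "a \<noteq> 0"
        using assms P' by (auto simp: localization_def)
      thus False using nu s0 unfolding nonunits_iff by force
    qed
  next
    assume "a \<in> P"
    have "a / s * y \<noteq> 1" if "y \<in> localization A P" for y
    proof
      assume eq: "a / s * y = 1"
      obtain b u where y: "y = b / u" "b \<in> A" "u \<in> A" "u \<notin> P"
        using \<open>y \<in> localization A P\<close> by (auto simp: localization_def)
      have "u \<noteq> 0" using y P' by auto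
      hence "a * b = s * u" using eq y s0 by (simp add: field_simps)
      moreover have "b * a \<in> P" using \<open>a \<in> P\<close> y P' by blast
      ultimately have "s * u \<in> P" by (simp add: mult.commute)
      thus False using assms y P' by blast
    qed
    thus "a / s \<in> nonunits (localization A P)" using in_loc by (simp add: nonunits_iff)
  qed
qed

text \<open>
  The generic point is the localization at the zero ideal.
\<close>

lemma fraction_field_in_spec_points:
  assumes A: "subring A (ambient :: 'a::field ring)"
  shows "fraction_field A \<in> spec_points A"
proof -
  have "primeideal {0} (as_ring A)"
    unfolding primeideal_as_ring_iff[OF A] using subring_rules[OF A] by auto
  moreover have "fraction_field A = localization A {0}"
    unfolding fraction_field_def localization_def by blast
  ultimately show ?thesis unfolding spec_points_def by blast
qed

lemma Union_spec_points:
  assumes A: "subring A (ambient :: 'a::field ring)"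
  shows "\<Union> (spec_points A) = fraction_field A"
proof
  show "\<Union> (spec_points A) \<subseteq> fraction_field A"
    unfolding spec_points_def localization_def fraction_field_def
    by (auto simp: primeideal_as_ring_iff[OF A])
qed (use fraction_field_in_spec_points[OF A] in blast)

section \<open>Algebraic elements\<close>

abbreviation algebraic_over :: "'a::field set \<Rightarrow> 'a \<Rightarrow> bool" where
  "algebraic_over L x \<equiv> \<not> ring.transcendental ambient L x"

lemma nat_pow_ambient [simp]: "x [^]\<^bsub>ambient\<^esub> (n::nat) = (x :: 'a::field) ^ n"
proof -
  interpret ring "ambient :: 'a ring" by (rule ring_ambient)
  show ?thesis by (induction n) (auto simp: nat_pow_Suc mult.commute)
qed

text \<open>
  The two polynomial libraries order coefficients oppositely: lists over a ring start with the leading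
  coefficient, and lists representing \<open>poly\<close> with the constant one.
\<close>

lemma eval_ambient: "ring.eval ambient p (x :: 'a::field) = poly (Poly (rev p)) x"
proof -
  interpret ring "ambient :: 'a ring" by (rule ring_ambient)
  show ?thesis by (induction p) (auto simp: Poly_append poly_monom add.commute)
qed

lemma set_coeffs_subset_iff:
  "0 \<in> L \<Longrightarrow> set (coeffs p) \<subseteq> L \<longleftrightarrow> (\<forall>i. Polynomial.coeff p i \<in> L)"
  using range_coeff[of p] by (metis UNIV_I image_subset_iff insert_subset)

lemma algebraic_over_iff_poly:
  assumes L: "subring L (ambient :: 'a::field ring)"
  shows "algebraic_over L x \<longleftrightarrow> (\<exists>p. p \<noteq> 0 \<and> (\<forall>i. Polynomial.coeff p i \<in> L) \<and> poly p x = 0)"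
proof
  interpret domain "ambient :: 'a ring" by (rule domain_ambient)
  assume "algebraic_over L x"
  then obtain p where p: "p \<in> carrier (univ_poly ambient L)" "p \<noteq> []" "eval p x = \<zero>\<^bsub>ambient\<^esub>"
    using algebraicE[OF L, of x] by (auto simp: over_def)
  hence p': "set p \<subseteq> L" "hd p \<noteq> 0" by (auto simp: univ_poly_def polynomial_def)
  define P where "P = Poly (rev p)"
  have coeff: "Polynomial.coeff P i = nth_default 0 (rev p) i" for i by (simp add: P_def)
  have "Polynomial.coeff P (length p - 1) = hd p"
    unfolding coeff using p(2) by (simp add: nth_default_nth rev_nth hd_conv_nth)
  hence "P \<noteq> 0" using p'(2) by auto
  moreover have "Polynomial.coeff P i \<in> L" for i
    unfolding coeff using p'(1) subring_rules(2)[OF L] nth_mem[of i "rev p"]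
    by (auto simp: nth_default_def)
  moreover have "poly P x = 0" using p(3) by (simp add: P_def eval_ambient)
  ultimately show "\<exists>p. p \<noteq> 0 \<and> (\<forall>i. Polynomial.coeff p i \<in> L) \<and> poly p x = 0" by blast
next
  interpret domain "ambient :: 'a ring" by (rule domain_ambient)
  assume "\<exists>p. p \<noteq> 0 \<and> (\<forall>i. Polynomial.coeff p i \<in> L) \<and> poly p x = 0"
  then obtain P where P: "P \<noteq> 0" "\<And>i. Polynomial.coeff P i \<in> L" "poly P x = 0" by blast
  have set: "set (coeffs P) \<subseteq> L" using P(2) set_coeffs_subset_iff[OF subring_rules(2)[OF L]] by blast
  have "rev (coeffs P) \<in> carrier (univ_poly ambient L)" "rev (coeffs P) \<noteq> []" "eval (rev (coeffs P)) x = \<zero>\<^bsub>ambient\<^esub>"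
    using P set by (auto simp: univ_poly_def polynomial_def hd_rev last_coeffs_eq_coeff_degree eval_ambient)
  thus "algebraic_over L x" using algebraicI[of _ L x] by (auto simp: over_def)
qed

lemma algebraic_over_mono:
  "algebraic_over L x \<Longrightarrow> L \<subseteq> L' \<Longrightarrow> algebraic_over L' (x :: 'a::field)"
  using ring.algebraic_mono[OF ring_ambient, of L L' x] by (auto simp: over_def)

lemma algebraic_over_self:
  assumes "subring L (ambient :: 'a::field ring)" "x \<in> L" shows "algebraic_over L x"
proof -
  interpret domain "ambient :: 'a ring" by (rule domain_ambient)
  show ?thesis using algebraic_self[OF assms] by (simp add: over_def)
qed

lemma algebraic_over_power:
  assumes L: "subring L (ambient :: 'a::field ring)" and "x ^ m \<in> L" "m > 0"
  shows "algebraic_over L x"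
  unfolding algebraic_over_iff_poly[OF L]
proof (intro exI conjI allI)
  let ?p = "Polynomial.monom 1 m - [:x ^ m:]"
  have "Polynomial.coeff ?p m = 1" using \<open>m > 0\<close> by (simp add: coeff_pCons split: nat.splits)
  thus "?p \<noteq> 0" by (metis coeff_0 zero_neq_one)
  show "Polynomial.coeff ?p i \<in> L" for i
    using assms subring_rules[OF L] by (auto simp: coeff_pCons split: nat.splits)
  show "poly ?p x = 0" by (simp add: poly_monom)
qed

lemma subfield_algebraic_over:
  assumes "subfield L (ambient :: 'a::field ring)"
  shows "subfield {x. algebraic_over L x} ambient"
  using field.subfield_of_algebraics[OF field_ambient assms] by (simp add: over_def)

text \<open>
  The finitely many coefficients of a polynomial for \<open>x\<close> generate a finite extension \<open>M\<close> of \<open>L\<close>, and \<open>x\<close>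
  is algebraic over \<open>M\<close>; hence \<open>x\<close> lies in an extension that is finite over \<open>L\<close>.
\<close>

lemma algebraic_over_trans:
  assumes L: "subfield L (ambient :: 'a::field ring)" and x: "algebraic_over {y. algebraic_over L y} x"
  shows "algebraic_over L x"
proof -
  interpret field "ambient :: 'a ring" by (rule field_ambient)
  have alg: "subring {y. algebraic_over L y} ambient"
    using subfield_algebraic_over[OF L] by (rule subfieldE)
  obtain p where p: "p \<noteq> 0" "\<And>i. algebraic_over L (Polynomial.coeff p i)" "poly p x = 0"
    using x unfolding algebraic_over_iff_poly[OF alg] by blast
  define M where "M = finite_extension L (coeffs p)"
  have coeffs: "(algebraic over L) y" if "y \<in> set (coeffs p)" for y
  proof -
    have "y \<in> range (Polynomial.coeff p)" using that by (simp add: range_coeff)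
    thus ?thesis using p(2) by (auto simp: over_def)
  qed
  have M: "subfield M ambient"
    unfolding M_def by (rule finite_extension_is_subfield[OF L]) (use coeffs in auto)
  have dim: "finite_dimension L M"
    unfolding M_def by (rule finite_extension_finite_dimension[OF L]) (use coeffs in auto)
  have "set (coeffs p) \<subseteq> M"
    unfolding M_def using finite_extension_mem[OF subfieldE(1)[OF L]] by auto
  hence "Polynomial.coeff p i \<in> M" for i
    using set_coeffs_subset_iff[OF subring_rules(2)[OF subfieldE(1)[OF M]]] by blast
  hence xM: "algebraic_over M x"
    using algebraic_over_iff_poly[OF subfieldE(1)[OF M]] p by blast
  hence "finite_dimension M (simple_extension M x)"
    by (intro finite_dimensionI[OF dimension_simple_extension[OF M]]) (auto simp: over_def)
  hence "finite_dimension L (simple_extension M x)"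
    using telescopic_base_dim(1)[OF L M dim] by auto
  hence "(algebraic over L) x"
    using finite_dimension_imp_algebraic[OF L simple_extension_is_subring[OF subfieldE(1)[OF M]]]
      simple_extension_mem[OF subfieldE(1)[OF M]] by auto
  thus ?thesis by (simp add: over_def)
qed

lemma algebraic_over_emb_iff:
  assumes f: "field_embedding f" and L: "subring L ambient"
  shows "algebraic_over (f ` L) (f x) \<longleftrightarrow> algebraic_over L x"
proof -
  have f0: "f 0 = 0" "\<And>x. f x = 0 \<longleftrightarrow> x = 0" using emb_0[OF f] emb_eq_0_iff[OF f] by auto
  have eval: "poly (map_poly f p) (f x) = f (poly p x)" for p
    by (induction p) (auto simp: map_poly_pCons f0 emb_add[OF f] emb_mult[OF f])
  show ?thesis
  proof
    assume "algebraic_over (f ` L) (f x)"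
    then obtain p where p: "p \<noteq> 0" "\<And>i. Polynomial.coeff p i \<in> f ` L" "poly p (f x) = 0"
      unfolding algebraic_over_iff_poly[OF emb_subring[OF f L]] by blast
    define q where "q = map_poly (inv_into UNIV f) p"
    have "inv_into UNIV f 0 = 0" using inv_f_f[OF emb_inj[OF f], of 0] by (simp add: f0)
    hence q: "Polynomial.coeff q i = inv_into UNIV f (Polynomial.coeff p i)" for i
      by (simp add: q_def coeff_map_poly)
    have "f (inv_into UNIV f (Polynomial.coeff p i)) = Polynomial.coeff p i" for i
      using p(2)[of i] by (intro f_inv_into_f) auto
    hence pq: "p = map_poly f q"
      by (intro poly_eqI) (simp add: coeff_map_poly f0 q)
    have "q \<noteq> 0" using pq p(1) by auto
    moreover have "Polynomial.coeff q i \<in> L" for i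
      using p(2)[of i] inv_f_f[OF emb_inj[OF f]] by (auto simp: q)
    moreover have "poly q x = 0" using p(3) by (simp add: pq eval f0)
    ultimately show "algebraic_over L x" unfolding algebraic_over_iff_poly[OF L] by blast
  next
    assume "algebraic_over L x"
    then obtain p where p: "p \<noteq> 0" "\<And>i. Polynomial.coeff p i \<in> L" "poly p x = 0"
      unfolding algebraic_over_iff_poly[OF L] by blast
    have "map_poly f p \<noteq> 0" using p(1) by (simp add: map_poly_eq_0_iff f0)
    thus "algebraic_over (f ` L) (f x)"
      unfolding algebraic_over_iff_poly[OF emb_subring[OF f L]] using p
      by (intro exI[of _ "map_poly f p"]) (auto simp: coeff_map_poly f0 eval)
  qed
qed

text \<open>
  The field generated by finitely many algebraic elements is already generated by them as a ring over
  \<open>L\<close>, so it is one of the iterated simple extensions, whose degrees are finite.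
\<close>

lemma finite_dimension_field_closure:
  assumes L: "subfield L (ambient :: 'a::field ring)" and "finite Z" "\<And>x. x \<in> Z \<Longrightarrow> algebraic_over L x"
  shows "ring.finite_dimension ambient L (field_closure (L \<union> Z))"
proof -
  interpret field "ambient :: 'a ring" by (rule field_ambient)
  obtain xs where xs: "set xs = Z" using finite_list[OF \<open>finite Z\<close>] by blast
  have alg: "(algebraic over L) x" if "x \<in> set xs" for x using that assms(3) xs by (auto simp: over_def)
  let ?E = "finite_extension L xs"
  have E: "subfield ?E ambient" using finite_extension_is_subfield[OF L, of xs] alg by auto
  have "L \<union> Z \<subseteq> ?E"
    using finite_extension_incl[of L xs] finite_extension_mem[OF subfieldE(1)[OF L], of xs] xs by auto
  hence "field_closure (L \<union> Z) \<subseteq> ?E" by (rule field_closure_least[OF E])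
  moreover have "?E \<subseteq> field_closure (L \<union> Z)"
    by (rule finite_extension_subring_incl[OF subring_field_closure])
      (use field_closure_superset[of "L \<union> Z"] xs in auto)
  ultimately have eq: "field_closure (L \<union> Z) = ?E" by blast
  show ?thesis unfolding eq using finite_extension_finite_dimension(1)[OF L, of xs] alg by auto
qed

section \<open>Algebraic independence one element at a time\<close>

text \<open>
  Coefficient functions with finite support on the monomials in \<open>S\<close> play the part of polynomials in
  variables indexed by \<open>S\<close>.
\<close>

definition mpoly_eval :: "('k::field \<Rightarrow> 'a::field) \<Rightarrow> ('a multiset \<Rightarrow> 'k) \<Rightarrow> 'a" where
  "mpoly_eval \<iota> c = (\<Sum>m | c m \<noteq> 0. \<iota> (c m) * prod_mset m)"

definition mpolys :: "'a set \<Rightarrow> ('a multiset \<Rightarrow> 'k::field) set" where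
  "mpolys S = {c. finite {m. c m \<noteq> 0} \<and> (\<forall>m. c m \<noteq> 0 \<longrightarrow> set_mset m \<subseteq> S)}"

lemma alg_independent_iff:
  "alg_independent \<iota> S \<longleftrightarrow> (\<forall>c\<in>mpolys S. mpoly_eval \<iota> c = 0 \<longrightarrow> (\<forall>m. c m = 0))"
  by (auto simp: alg_independent_def mpolys_def mpoly_eval_def)

lemma mpolysI:
  assumes "finite M" "\<And>m. c m \<noteq> 0 \<Longrightarrow> m \<in> M" "\<And>m. m \<in> M \<Longrightarrow> set_mset m \<subseteq> S"
  shows "c \<in> mpolys S"
  unfolding mpolys_def using assms finite_subset[of "{m. c m \<noteq> 0}" M] by auto

lemma mpoly_eval_superset:
  assumes "field_embedding \<iota>" "finite M" "\<And>m. c m \<noteq> 0 \<Longrightarrow> m \<in> M"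
  shows "mpoly_eval \<iota> c = (\<Sum>m\<in>M. \<iota> (c m) * prod_mset m)"
  unfolding mpoly_eval_def
  by (rule sum.mono_neutral_left) (use assms emb_0[OF assms(1)] in auto)

text \<open>
  The values of polynomials form a subring.  Closure under multiplication is the convolution of
  coefficient functions: the pairs of monomials are grouped by their product.
\<close>

lemma adjoin_ring_mpolys:
  assumes \<iota>: "field_embedding (\<iota> :: 'k::field \<Rightarrow> 'a::field)"
  shows "adjoin_ring \<iota> S \<subseteq> mpoly_eval \<iota> ` mpolys S"
proof -
  let ?W = "mpoly_eval \<iota> ` mpolys S"
  have const: "\<iota> a \<in> ?W" for a
  proof (rule image_eqI)
    let ?c = "\<lambda>m. if m = {#} then a else 0"
    show "\<iota> a = mpoly_eval \<iota> ?c" by (subst mpoly_eval_superset[OF \<iota>, of "{{#}}"]) (auto split: if_splits)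
    show "?c \<in> mpolys S" by (rule mpolysI[of "{{#}}"]) (auto split: if_splits)
  qed
  have "subring ?W ambient"
    unfolding subring_ambient_iff
  proof (intro conjI ballI)
    show "1 \<in> ?W" using const[of 1] by (simp add: emb_1[OF \<iota>])
  next
    fix x assume "x \<in> ?W"
    then obtain c where x: "x = mpoly_eval \<iota> c" and c: "c \<in> mpolys S" by blast
    let ?M = "{m. c m \<noteq> 0}"
    have M: "finite ?M" "\<And>m. m \<in> ?M \<Longrightarrow> set_mset m \<subseteq> S" using c by (auto simp: mpolys_def)
    show "- x \<in> ?W"
    proof (rule image_eqI)
      show "- x = mpoly_eval \<iota> (\<lambda>m. - c m)"
        unfolding x by (subst (1 2) mpoly_eval_superset[OF \<iota> M(1)])
          (auto simp: emb_minus[OF \<iota>] sum_negf)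
      show "(\<lambda>m. - c m) \<in> mpolys S" by (rule mpolysI[OF M(1)]) (use M in auto)
    qed
    fix y assume "y \<in> ?W"
    then obtain d where y: "y = mpoly_eval \<iota> d" and d: "d \<in> mpolys S" by blast
    let ?N = "{m. d m \<noteq> 0}"
    have N: "finite ?N" "\<And>m. m \<in> ?N \<Longrightarrow> set_mset m \<subseteq> S" using d by (auto simp: mpolys_def)
    show "x + y \<in> ?W"
    proof (rule image_eqI)
      have MN: "finite (?M \<union> ?N)" using M N by blast
      show "x + y = mpoly_eval \<iota> (\<lambda>m. c m + d m)"
        unfolding x y by (subst (1 2 3) mpoly_eval_superset[OF \<iota> MN])
          (auto simp: emb_add[OF \<iota>] sum.distrib algebra_simps)
      show "(\<lambda>m. c m + d m) \<in> mpolys S" by (rule mpolysI[OF MN]) (use M N in auto)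
    qed
    show "x * y \<in> ?W"
    proof (rule image_eqI)
      let ?e = "\<lambda>m. \<Sum>(a, b) \<in> {u \<in> ?M \<times> ?N. fst u + snd u = m}. c a * d b"
      let ?Q = "(\<lambda>(a, b). a + b) ` (?M \<times> ?N)"
      have Q: "finite ?Q" using M N by blast
      have sub: "m \<in> ?Q" if "?e m \<noteq> 0" for m
      proof (rule ccontr)
        assume "m \<notin> ?Q"
        hence "{u \<in> ?M \<times> ?N. fst u + snd u = m} = {}" by force
        thus False using that by (metis (lifting) sum.empty)
      qed
      show "?e \<in> mpolys S"
      proof (rule mpolysI[OF Q sub])
        fix m assume "m \<in> ?Q"
        then obtain a b where "m = a + b" "a \<in> ?M" "b \<in> ?N" by auto
        thus "set_mset m \<subseteq> S" using M(2) N(2) by auto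
      qed
      have "mpoly_eval \<iota> ?e = (\<Sum>m\<in>?Q. \<iota> (?e m) * prod_mset m)"
        by (rule mpoly_eval_superset[OF \<iota> Q sub])
      also have "\<dots> = (\<Sum>m\<in>?Q. \<Sum>u \<in> {u \<in> ?M \<times> ?N. (\<lambda>(a, b). a + b) u = m}.
          (\<iota> (c (fst u)) * prod_mset (fst u)) * (\<iota> (d (snd u)) * prod_mset (snd u)))"
        unfolding emb_sum[OF \<iota>] sum_distrib_right
        by (intro sum.cong) (auto simp: emb_mult[OF \<iota>])
      also have "\<dots> = (\<Sum>u\<in>?M \<times> ?N. (\<iota> (c (fst u)) * prod_mset (fst u)) * (\<iota> (d (snd u)) * prod_mset (snd u)))"
        by (rule sum.group) (use M N Q in auto)
      also have "\<dots> = x * y"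
        unfolding x y mpoly_eval_def sum_product sum.cartesian_product by (simp add: case_prod_beta)
      finally show "x * y = mpoly_eval \<iota> ?e" ..
    qed
  qed
  moreover have "s \<in> ?W" if "s \<in> S" for s
  proof (rule image_eqI)
    let ?c = "\<lambda>m. if m = {#s#} then 1 else (0 :: 'k)"
    show "s = mpoly_eval \<iota> ?c"
      by (subst mpoly_eval_superset[OF \<iota>, of "{{#s#}}"]) (auto simp: emb_1[OF \<iota>] split: if_splits)
    show "?c \<in> mpolys S" by (rule mpolysI[of "{{#s#}}"]) (use that in \<open>auto split: if_splits\<close>)
  qed
  ultimately show ?thesis unfolding adjoin_ring_def using const by (intro ring_closure_least) auto
qed

lemma mpoly_eval_in_adjoin_ring:
  assumes "c \<in> mpolys S"
  shows "mpoly_eval \<iota> c \<in> adjoin_ring \<iota> S"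
proof -
  note rules = subring_rules[OF subring_ring_closure[of "range \<iota> \<union> S"]]
  have sup: "range \<iota> \<union> S \<subseteq> adjoin_ring \<iota> S" unfolding adjoin_ring_def by (rule ring_closure_superset)
  have "prod_mset m \<in> adjoin_ring \<iota> S" if "set_mset m \<subseteq> S" for m
    using that by (induction m) (use rules sup in \<open>auto simp: adjoin_ring_def\<close>)
  thus ?thesis
    unfolding mpoly_eval_def adjoin_ring_def using assms sup
    by (intro subring_sum[OF subring_ring_closure] rules(6)) (auto simp: mpolys_def adjoin_ring_def)
qed

text \<open>
  The coefficient of \<open>t ^ i\<close>, when a polynomial in \<open>t\<close> and other variables is regarded as a polynomial
  in \<open>t\<close> whose coefficients are polynomials in the other variables.  The guard keeps \<open>t\<close> out of these
  coefficients.
\<close>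

definition mpoly_slice :: "'a \<Rightarrow> ('a multiset \<Rightarrow> 'k::field) \<Rightarrow> nat \<Rightarrow> 'a multiset \<Rightarrow> 'k" where
  "mpoly_slice t c i = (\<lambda>m. if t \<in># m then 0 else c (m + replicate_mset i t))"

lemma mset_split: "filter_mset (\<lambda>x. x \<noteq> t) m + replicate_mset (count m t) t = m"
  by (rule multiset_eqI) auto

lemma filter_add_replicate:
  assumes "t \<notin># m"
  shows "filter_mset (\<lambda>x. x \<noteq> t) (m + replicate_mset i t) = m"
  by (rule multiset_eqI) (use assms in \<open>auto simp: not_in_iff\<close>)

lemma mpoly_slice_in_mpolys:
  assumes "c \<in> mpolys (insert t S)"
  shows "mpoly_slice t c i \<in> mpolys S"
proof (rule mpolysI)
  let ?M = "{m. c m \<noteq> 0 \<and> set_mset m \<subseteq> insert t S}"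
  show "finite (filter_mset (\<lambda>x. x \<noteq> t) ` ?M)"
    using assms by (auto simp: mpolys_def intro: finite_subset[of _ "{m. c m \<noteq> 0}"])
  fix m assume "mpoly_slice t c i m \<noteq> 0"
  hence "t \<notin># m" "c (m + replicate_mset i t) \<noteq> 0" by (auto simp: mpoly_slice_def split: if_splits)
  moreover from this have "set_mset (m + replicate_mset i t) \<subseteq> insert t S"
    using assms unfolding mpolys_def by blast
  ultimately show "m \<in> filter_mset (\<lambda>x. x \<noteq> t) ` ?M"
    using filter_add_replicate[of t m i]
    by (intro image_eqI[of _ _ "m + replicate_mset i t"]) auto
qed auto

lemma mpoly_eval_slices:
  assumes \<iota>: "field_embedding \<iota>" and c: "finite {m. c m \<noteq> 0}" and n: "\<And>m. c m \<noteq> 0 \<Longrightarrow> count m t \<le> n"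
  shows "mpoly_eval \<iota> c = (\<Sum>i\<le>n. mpoly_eval \<iota> (mpoly_slice t c i) * t ^ i)"
proof -
  have "mpoly_eval \<iota> c = (\<Sum>i\<in>{..n}. \<Sum>m \<in> {m \<in> {m. c m \<noteq> 0}. count m t = i}. \<iota> (c m) * prod_mset m)"
    unfolding mpoly_eval_def by (rule sum.group[symmetric]) (use c n in auto)
  also have "\<dots> = (\<Sum>i\<in>{..n}. mpoly_eval \<iota> (mpoly_slice t c i) * t ^ i)"
  proof (rule sum.cong[OF refl])
    fix i
    show "(\<Sum>m \<in> {m \<in> {m. c m \<noteq> 0}. count m t = i}. \<iota> (c m) * prod_mset m) =
      mpoly_eval \<iota> (mpoly_slice t c i) * t ^ i"
      unfolding mpoly_eval_def sum_distrib_right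
    proof (rule sum.reindex_bij_witness[of _ "\<lambda>m. m + replicate_mset i t" "filter_mset (\<lambda>x. x \<noteq> t)"])
      fix m assume m: "m \<in> {m \<in> {m. c m \<noteq> 0}. count m t = i}"
      hence split: "filter_mset (\<lambda>x. x \<noteq> t) m + replicate_mset i t = m"
        using mset_split[of t m] by simp
      thus "filter_mset (\<lambda>x. x \<noteq> t) m + replicate_mset i t = m" .
      show "filter_mset (\<lambda>x. x \<noteq> t) m \<in> {m. mpoly_slice t c i m \<noteq> 0}"
        using m split by (auto simp: mpoly_slice_def)
      have "prod_mset m = prod_mset (filter_mset (\<lambda>x. x \<noteq> t) m) * t ^ i"
        by (subst split[symmetric]) simp
      thus "\<iota> (mpoly_slice t c i (filter_mset (\<lambda>x. x \<noteq> t) m)) * prod_mset (filter_mset (\<lambda>x. x \<noteq> t) m) * t ^ i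
          = \<iota> (c m) * prod_mset m"
        using split by (simp add: mpoly_slice_def)
    next
      fix m assume m: "m \<in> {m. mpoly_slice t c i m \<noteq> 0}"
      hence t: "t \<notin># m" "c (m + replicate_mset i t) \<noteq> 0"
        by (auto simp: mpoly_slice_def split: if_splits)
      show "filter_mset (\<lambda>x. x \<noteq> t) (m + replicate_mset i t) = m"
        by (rule filter_add_replicate[OF t(1)])
      show "m + replicate_mset i t \<in> {m \<in> {m. c m \<noteq> 0}. count m t = i}"
        using t by (auto simp: not_in_iff)
    qed
  qed
  finally show ?thesis .
qed

lemma adjoin_field_fraction_field: "adjoin_field \<iota> S = fraction_field (adjoin_ring \<iota> S)"
  by (simp add: adjoin_field_def adjoin_ring_def fraction_field_ring_closure)

lemma subfield_adjoin_field: "subfield (adjoin_field \<iota> S) ambient"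
  unfolding adjoin_field_def by (rule subfield_field_closure)

lemma subring_adjoin_field: "subring (adjoin_field \<iota> S) ambient"
  unfolding adjoin_field_def by (rule subring_field_closure)

lemma subring_adjoin_ring: "subring (adjoin_ring \<iota> S) ambient"
  unfolding adjoin_ring_def by (rule subring_ring_closure)

lemma adjoin_field_superset: "range \<iota> \<subseteq> adjoin_field \<iota> S" "S \<subseteq> adjoin_field \<iota> S"
  unfolding adjoin_field_def using field_closure_superset[of "range \<iota> \<union> S"] by auto

lemma adjoin_field_mono: "S \<subseteq> S' \<Longrightarrow> adjoin_field \<iota> S \<subseteq> adjoin_field \<iota> S'"
  unfolding adjoin_field_def by (rule field_closure_mono) auto

lemma adjoin_ring_subset_adjoin_field: "adjoin_ring \<iota> S \<subseteq> adjoin_field \<iota> S"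
  unfolding adjoin_ring_def adjoin_field_def
  by (rule ring_closure_least[OF subring_field_closure field_closure_superset])

lemma alg_independent_empty:
  assumes "field_embedding \<iota>"
  shows "alg_independent \<iota> {}"
  unfolding alg_independent_iff
proof (intro ballI impI allI)
  fix c m assume c: "c \<in> mpolys {}" "mpoly_eval \<iota> c = 0"
  have supp: "m = {#}" if "c m \<noteq> 0" for m using c(1) that by (auto simp: mpolys_def)
  have "mpoly_eval \<iota> c = \<iota> (c {#})"
    by (subst mpoly_eval_superset[OF assms, of "{{#}}"]) (use supp in auto)
  thus "c m = 0" using c(2) supp[of m] emb_eq_0_iff[OF assms] by auto
qed

lemma alg_independent_subset:
  assumes "alg_independent \<iota> S" "S' \<subseteq> S"
  shows "alg_independent \<iota> S'"
proof -
  have "mpolys S' \<subseteq> (mpolys S :: ('b multiset \<Rightarrow> 'a) set)" using assms(2) by (auto simp: mpolys_def)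
  thus ?thesis using assms(1) unfolding alg_independent_iff by blast
qed

text \<open>
  Suppose that \<open>t\<close> is a root of a nonzero polynomial over \<open>k(S)\<close>.  After clearing denominators its
  coefficients are values of polynomials in \<open>S\<close>, which are the slices of a polynomial in \<open>S\<close> and \<open>t\<close>
  that vanishes at the given elements.  By independence that polynomial is zero, and so are its slices.
\<close>

lemma alg_independent_insert_imp_transcendental:
  fixes \<iota> :: "'k::field \<Rightarrow> 'a::field"
  assumes \<iota>: "field_embedding \<iota>" and "t \<notin> S" and ind: "alg_independent \<iota> (insert t S)"
  shows "ring.transcendental ambient (adjoin_field \<iota> S) t"
proof (rule ccontr)
  assume "algebraic_over (adjoin_field \<iota> S) t"
  then obtain p where p: "p \<noteq> 0" "\<And>i. Polynomial.coeff p i \<in> adjoin_field \<iota> S" "poly p t = 0"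
    unfolding algebraic_over_iff_poly[OF subring_adjoin_field] by blast
  have "range (Polynomial.coeff p) \<subseteq> fraction_field (adjoin_ring \<iota> S)"
    using p(2) by (auto simp: adjoin_field_fraction_field)
  moreover have "finite (range (Polynomial.coeff p))" by (simp add: range_coeff)
  ultimately obtain h where h: "h \<noteq> 0" "\<And>i. h * Polynomial.coeff p i \<in> adjoin_ring \<iota> S"
    using common_denominator[OF subring_adjoin_ring, of "range (Polynomial.coeff p)" \<iota> S] by auto
  have "\<exists>c\<in>mpolys S. h * Polynomial.coeff p i = mpoly_eval \<iota> c" for i
    using h(2)[of i] adjoin_ring_mpolys[OF \<iota>, of S] by blast
  then obtain c where c: "\<And>i. c i \<in> mpolys S" "\<And>i. h * Polynomial.coeff p i = mpoly_eval \<iota> (c i)"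
    by metis
  let ?n = "Polynomial.degree p"
  define d where "d = (\<lambda>m. if count m t \<le> ?n then c (count m t) (filter_mset (\<lambda>x. x \<noteq> t) m) else 0)"
  let ?M = "\<Union>i\<le>?n. (\<lambda>m. m + replicate_mset i t) ` {m. c i m \<noteq> 0}"
  have M: "finite ?M" using c(1) by (auto simp: mpolys_def)
  have supp: "m \<in> ?M" if "d m \<noteq> 0" for m
  proof -
    have i: "count m t \<le> ?n" "c (count m t) (filter_mset (\<lambda>x. x \<noteq> t) m) \<noteq> 0"
      using that by (auto simp: d_def split: if_splits)
    show ?thesis
      using i mset_split[of t m, symmetric]
      by (intro UN_I[of "count m t"] image_eqI[of _ _ "filter_mset (\<lambda>x. x \<noteq> t) m"]) auto
  qed
  have d: "d \<in> mpolys (insert t S)"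
  proof (rule mpolysI[OF M supp])
    fix m assume "m \<in> ?M"
    then obtain i m' where m: "m = m' + replicate_mset i t" "c i m' \<noteq> 0" by auto
    moreover have "set_mset m' \<subseteq> S" using m(2) c(1)[of i] by (auto simp: mpolys_def)
    ultimately show "set_mset m \<subseteq> insert t S" by (auto split: if_splits)
  qed
  have slice: "mpoly_slice t d i = c i" if "i \<le> ?n" for i
  proof
    fix m
    show "mpoly_slice t d i m = c i m"
    proof (cases "t \<in># m")
      case True
      have "c i m = 0" using c(1)[of i] True \<open>t \<notin> S\<close> by (auto simp: mpolys_def)
      thus ?thesis using True by (simp add: mpoly_slice_def)
    next
      case False
      hence "count (m + replicate_mset i t) t = i" by (simp add: not_in_iff)
      thus ?thesis
        using False that unfolding mpoly_slice_def d_def by (simp add: filter_add_replicate del: filter_union_mset)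
    qed
  qed
  have "mpoly_eval \<iota> d = (\<Sum>i\<le>?n. mpoly_eval \<iota> (mpoly_slice t d i) * t ^ i)"
    by (rule mpoly_eval_slices[OF \<iota>]) (use d in \<open>auto simp: mpolys_def d_def split: if_splits\<close>)
  also have "\<dots> = (\<Sum>i\<le>?n. h * (Polynomial.coeff p i * t ^ i))"
    by (rule sum.cong) (auto simp: slice c(2)[symmetric] mult.assoc)
  also have "\<dots> = h * poly p t" by (simp add: poly_altdef sum_distrib_left)
  finally have "mpoly_eval \<iota> d = 0" using p(3) by simp
  hence d0: "d m = 0" for m using ind d unfolding alg_independent_iff by blast
  have "c i m = 0" if "i \<le> ?n" for i m
    using slice[OF that, THEN fun_cong, of m] d0 by (auto simp: mpoly_slice_def split: if_splits)
  hence "mpoly_eval \<iota> (c ?n) = 0" by (simp add: mpoly_eval_def)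
  hence "h * Polynomial.coeff p ?n = 0" using c(2) by simp
  thus False using h(1) p(1) by simp
qed

text \<open>
  In a relation between \<open>t\<close> and the elements of \<open>S\<close>, the coefficients of the powers of \<open>t\<close> vanish since
  \<open>t\<close> is transcendental over \<open>k(S)\<close>; these coefficients are relations between elements of \<open>S\<close>.
\<close>

lemma alg_independent_insert:
  fixes \<iota> :: "'k::field \<Rightarrow> 'a::field"
  assumes \<iota>: "field_embedding \<iota>" and ind: "alg_independent \<iota> S"
    and t: "ring.transcendental ambient (adjoin_field \<iota> S) t"
  shows "alg_independent \<iota> (insert t S)"
  unfolding alg_independent_iff
proof (intro ballI impI allI)
  fix c m assume c: "c \<in> mpolys (insert t S)" "mpoly_eval \<iota> c = 0"
  define n where "n = Max (insert 0 ((\<lambda>m. count m t) ` {m. c m \<noteq> 0}))"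
  have fin: "finite {m. c m \<noteq> 0}" using c by (auto simp: mpolys_def)
  have n: "count m t \<le> n" if "c m \<noteq> 0" for m
    unfolding n_def using fin that by (intro Max_ge) auto
  have slice: "mpoly_slice t c i \<in> mpolys S" for i by (rule mpoly_slice_in_mpolys[OF c(1)])
  define p where "p = (\<Sum>i\<le>n. Polynomial.monom (mpoly_eval \<iota> (mpoly_slice t c i)) i)"
  have coeff: "Polynomial.coeff p i = (if i \<le> n then mpoly_eval \<iota> (mpoly_slice t c i) else 0)" for i
    by (simp add: p_def coeff_sum)
  have "poly p t = 0"
    using mpoly_eval_slices[OF \<iota> fin n] c(2) by (simp add: p_def poly_sum poly_monom)
  moreover have "Polynomial.coeff p i \<in> adjoin_field \<iota> S" for i
    unfolding coeff using mpoly_eval_in_adjoin_ring[OF slice, of \<iota> i] adjoin_ring_subset_adjoin_field[of \<iota> S]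
      subring_rules(2)[OF subring_adjoin_field] by auto
  ultimately have "p = 0" using t algebraic_over_iff_poly[OF subring_adjoin_field, of \<iota> S t] by blast
  hence zero: "mpoly_slice t c i m = 0" if "i \<le> n" for i m
    using coeff[of i] that ind slice unfolding alg_independent_iff by auto
  show "c m = 0"
  proof (rule ccontr)
    assume "c m \<noteq> 0"
    hence "mpoly_slice t c (count m t) (filter_mset (\<lambda>x. x \<noteq> t) m) = 0" using zero n by blast
    thus False using \<open>c m \<noteq> 0\<close> mset_split[of t m] by (simp add: mpoly_slice_def)
  qed
qed

lemma alg_independent_singleton_imp_transcendental:
  assumes \<phi>: "field_embedding \<phi>" and "alg_independent \<phi> {s}"
  shows "ring.transcendental ambient (range \<phi>) s"
proof -
  have "subfield (range \<phi>) ambient" by (rule emb_subfield[OF \<phi> subfield_UNIV])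
  hence "adjoin_field \<phi> {} = range \<phi>" by (simp add: adjoin_field_def field_closure_subfield)
  thus ?thesis using alg_independent_insert_imp_transcendental[OF \<phi>, of s "{}"] assms(2) by simp
qed

lemma alg_independent_nonzero:
  assumes \<iota>: "field_embedding \<iota>" and "alg_independent \<iota> S"
  shows "0 \<notin> S"
proof
  assume "0 \<in> S"
  hence "insert 0 (S - {0}) = S" by blast
  hence "ring.transcendental ambient (adjoin_field \<iota> (S - {0})) 0"
    using alg_independent_insert_imp_transcendental[OF \<iota>, of 0 "S - {0}"] assms(2) by simp
  thus False
    using algebraic_over_self[OF subring_adjoin_field] subring_rules(2)[OF subring_adjoin_field] by blast
qed

section \<open>Transcendence degree\<close>

lemma algebraic_over_adjoin_field_trans:
  assumes T: "\<And>t. t \<in> T \<Longrightarrow> algebraic_over (adjoin_field \<iota> S) t" and x: "algebraic_over (adjoin_field \<iota> T) x"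
  shows "algebraic_over (adjoin_field \<iota> S) x"
proof -
  have "adjoin_field \<iota> T \<subseteq> {y. algebraic_over (adjoin_field \<iota> S) y}"
    unfolding adjoin_field_def[of \<iota> T]
    by (rule field_closure_least[OF subfield_algebraic_over[OF subfield_adjoin_field]])
      (use T adjoin_field_superset(1)[of \<iota> S] algebraic_over_self[OF subring_adjoin_field] in blast)
  thus ?thesis
    using algebraic_over_trans[OF subfield_adjoin_field] algebraic_over_mono[OF x] by blast
qed

text \<open>
  Steinitz's exchange argument, by induction on the number of elements of \<open>S\<close> outside \<open>T\<close>.  Such an
  element \<open>x\<close> is transcendental over \<open>k(S - {x})\<close>, so by transitivity some \<open>y\<close> in \<open>T\<close> is transcendental over
  that field as well.  Then \<open>x\<close> may be exchanged for \<open>y\<close> without loss of independence.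
\<close>

lemma alg_independent_card_le:
  assumes \<iota>: "field_embedding \<iota>" and "finite T" "finite S" "alg_independent \<iota> S"
    and "\<And>x. x \<in> S \<Longrightarrow> algebraic_over (adjoin_field \<iota> T) x"
  shows "card S \<le> card T"
  using assms(3-5)
proof (induction "card (S - T)" arbitrary: S)
  case 0
  hence "S \<subseteq> T" by auto
  thus ?case using \<open>finite T\<close> by (simp add: card_mono)
next
  case (Suc n)
  hence "S - T \<noteq> {}" by force
  then obtain x where x: "x \<in> S" "x \<notin> T" by blast
  let ?S = "S - {x}"
  have S: "insert x ?S = S" using x by blast
  have "ring.transcendental ambient (adjoin_field \<iota> ?S) x"
    by (rule alg_independent_insert_imp_transcendental[OF \<iota>]) (use Suc.prems S in auto)
  then obtain y where y: "y \<in> T" "ring.transcendental ambient (adjoin_field \<iota> ?S) y"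
    using algebraic_over_adjoin_field_trans[of T \<iota> ?S x] Suc.prems(3)[OF x(1)] by blast
  have "y \<notin> ?S"
    using y(2) adjoin_field_superset(2)[of ?S \<iota>] algebraic_over_self[OF subring_adjoin_field, of y \<iota> ?S] by blast
  hence card: "card (insert y ?S) = card S"
    using Suc.prems(1) x(1) by (simp add: card_Suc_Diff1 del: card_Diff_insert)
  have "S - T = insert x (insert y ?S - T)" "x \<notin> insert y ?S - T" using x y by auto
  hence n: "n = card (insert y ?S - T)"
    using Suc.hyps(2) Suc.prems(1) by (metis card_insert_disjoint finite_Diff finite_insert nat.inject)
  have "card (insert y ?S) \<le> card T"
  proof (rule Suc.hyps(1)[OF n])
    show "finite (insert y ?S)" using Suc.prems(1) by simp
    show "alg_independent \<iota> (insert y ?S)"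
      by (rule alg_independent_insert[OF \<iota> _ y(2)]) (use alg_independent_subset Suc.prems(2) in blast)
    show "algebraic_over (adjoin_field \<iota> T) z" if "z \<in> insert y ?S" for z
      using that Suc.prems(3) y(1) adjoin_field_superset(2)[of T \<iota>]
        algebraic_over_self[OF subring_adjoin_field, of z \<iota> T] by blast
  qed
  thus ?case using card by simp
qed

text \<open>
  The dimension was defined as a minimum over the finite transcendence bases, but all of these have the
  same size.
\<close>

lemma variety_dim_eq_card:
  assumes \<iota>: "field_embedding \<iota>" and "finite S" and S: "transcendence_basis \<iota> (function_field V) S"
  shows "variety_dim \<iota> V = card S"
  unfolding variety_dim_def
proof (rule Least_equality)
  show "\<exists>S'. finite S' \<and> card S' = card S \<and> transcendence_basis \<iota> (function_field V) S'"
    using assms by blast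
  fix d assume "\<exists>S'. finite S' \<and> card S' = d \<and> transcendence_basis \<iota> (function_field V) S'"
  then obtain S' where S': "finite S'" "card S' = d" "transcendence_basis \<iota> (function_field V) S'"
    by blast
  show "card S \<le> d"
    unfolding S'(2)[symmetric]
    by (rule alg_independent_card_le[OF \<iota> S'(1) \<open>finite S\<close>])
      (use S S'(3) in \<open>auto simp: transcendence_basis_def\<close>)
qed

lemma transcendence_basis_adjoin_field:
  assumes "alg_independent \<iota> S"
  shows "transcendence_basis \<iota> (adjoin_field \<iota> S) S"
  unfolding transcendence_basis_def
  using assms adjoin_field_superset(2) algebraic_over_self[OF subring_adjoin_field] by blast

text \<open>
  A maximal independent subset of a generating set.
\<close>

lemma ex_transcendence_basis:
  assumes \<iota>: "field_embedding \<iota>" and "finite S"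
  shows "\<exists>D\<subseteq>S. transcendence_basis \<iota> (adjoin_field \<iota> S) D"
proof -
  let ?I = "{D. D \<subseteq> S \<and> alg_independent \<iota> D}"
  have I: "finite ?I" "?I \<noteq> {}"
    using \<open>finite S\<close> alg_independent_empty[OF \<iota>] by auto
  obtain D where "D \<in> ?I" and maximal: "\<forall>D'\<in>?I. D \<subseteq> D' \<longrightarrow> D = D'"
    using finite_has_maximal[OF I] by (elim bexE)
  hence D: "D \<subseteq> S" "alg_independent \<iota> D" by simp_all
  have max: "D = D'" if "D' \<subseteq> S" "alg_independent \<iota> D'" "D \<subseteq> D'" for D'
    using maximal that by simp
  have S: "algebraic_over (adjoin_field \<iota> D) x" if "x \<in> S" for x
  proof
    assume x: "ring.transcendental ambient (adjoin_field \<iota> D) x"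
    hence "D = insert x D" using alg_independent_insert[OF \<iota> D(2) x] D(1) that by (intro max) auto
    hence "x \<in> adjoin_field \<iota> D" using adjoin_field_superset(2) by blast
    thus False using x algebraic_over_self[OF subring_adjoin_field] by blast
  qed
  have "algebraic_over (adjoin_field \<iota> D) x" if "x \<in> adjoin_field \<iota> S" for x
    by (rule algebraic_over_adjoin_field_trans[OF S algebraic_over_self[OF subring_adjoin_field that]])
  thus ?thesis
    unfolding transcendence_basis_def using D adjoin_field_superset(2)[of S \<iota>] by blast
qed

text \<open>
  In the following three lemmas the structure maps \<open>\<iota>\<close> and \<open>\<kappa>\<close> are only related by the images of the
  ground field, and not by \<open>f \<circ> \<iota> = \<kappa>\<close>.  The embedding \<open>f\<close> may thus be linear over \<open>k\<close> up to an
  automorphism of \<open>k\<close>, as is the case for the extraction of \<open>q\<close>-th roots.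
\<close>

lemma emb_adjoin_field:
  assumes "field_embedding f" "f ` range \<iota> = range \<kappa>"
  shows "f ` adjoin_field \<iota> S = adjoin_field \<kappa> (f ` S)"
  unfolding adjoin_field_def emb_field_closure[OF assms(1)] image_Un assms(2) ..

lemma emb_alg_independent:
  assumes f: "field_embedding f" and emb: "field_embedding \<iota>" "field_embedding \<kappa>"
    and range: "f ` range \<iota> = range \<kappa>" and "finite S" "alg_independent \<iota> S"
  shows "alg_independent \<kappa> (f ` S)"
  using assms(5,6)
proof (induction S rule: finite_induct)
  case empty
  show ?case using alg_independent_empty[OF emb(2)] by simp
next
  case (insert x S)
  have "ring.transcendental ambient (adjoin_field \<iota> S) x"
    by (rule alg_independent_insert_imp_transcendental[OF emb(1) insert.hyps(2) insert.prems])
  hence "ring.transcendental ambient (adjoin_field \<kappa> (f ` S)) (f x)"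
    using algebraic_over_emb_iff[OF f subring_adjoin_field[of \<iota> S], of x] emb_adjoin_field[OF f range, of S] by simp
  moreover have "alg_independent \<kappa> (f ` S)"
    using insert.IH alg_independent_subset[OF insert.prems] by blast
  ultimately show ?case using alg_independent_insert[OF emb(2)] by simp
qed

lemma emb_transcendence_basis:
  assumes f: "field_embedding f" and emb: "field_embedding \<iota>" "field_embedding \<kappa>"
    and range: "f ` range \<iota> = range \<kappa>" and "finite S" "transcendence_basis \<iota> F S"
  shows "transcendence_basis \<kappa> (f ` F) (f ` S)"
  unfolding transcendence_basis_def
proof (intro conjI ballI)
  note S = assms(6)[unfolded transcendence_basis_def]
  show "f ` S \<subseteq> f ` F" using S by blast
  show "alg_independent \<kappa> (f ` S)" using emb_alg_independent[OF assms(1-5)] S by blast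
  fix y assume "y \<in> f ` F"
  then obtain x where x: "y = f x" "x \<in> F" by blast
  hence "algebraic_over (adjoin_field \<iota> S) x" using S by blast
  thus "algebraic_over (adjoin_field \<kappa> (f ` S)) y"
    using algebraic_over_emb_iff[OF f subring_adjoin_field] unfolding emb_adjoin_field[OF f range, symmetric] x(1)
    by blast
qed

text \<open>
  Adjoining a transcendental element \<open>t\<close> raises the transcendence degree by one, and passing from \<open>K(t)\<close>
  to \<open>F\<close> does not change it, because every element of \<open>F\<close> has a positive power in \<open>K(t)\<close>.
\<close>

lemma transcendence_basis_insert:
  assumes \<iota>: "field_embedding \<iota>" and K: "subfield K ambient" and D: "transcendence_basis \<iota> K D"
    and t: "ring.transcendental ambient K t" and range: "range \<iota> \<subseteq> K"
    and F: "K \<subseteq> F" "t \<in> F" "q > 0" "\<And>x. x \<in> F \<Longrightarrow> x ^ q \<in> field_closure (K \<union> {t})"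
  shows "transcendence_basis \<iota> F (insert t D)" "t \<notin> D"
proof -
  note D' = D[unfolded transcendence_basis_def]
  have "adjoin_field \<iota> D \<subseteq> K" unfolding adjoin_field_def
    by (rule field_closure_least[OF K]) (use D' range in blast)
  hence t': "ring.transcendental ambient (adjoin_field \<iota> D) t"
    using t algebraic_over_mono by blast
  show "t \<notin> D"
    using t' algebraic_over_self[OF subring_adjoin_field] adjoin_field_superset(2) by blast
  let ?M = "adjoin_field \<iota> (insert t D)"
  let ?N = "{y. algebraic_over ?M y}"
  have N: "subfield ?N ambient" by (rule subfield_algebraic_over[OF subfield_adjoin_field])
  have "K \<subseteq> ?N"
  proof
    fix x assume "x \<in> K"
    hence "algebraic_over (adjoin_field \<iota> D) x" using D' by blast
    moreover have "adjoin_field \<iota> D \<subseteq> ?M" by (rule adjoin_field_mono) blast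
    ultimately show "x \<in> ?N" using algebraic_over_mono by blast
  qed
  moreover have "t \<in> ?M" using adjoin_field_superset(2)[of "insert t D" \<iota>] by simp
  hence "t \<in> ?N" using algebraic_over_self[OF subring_adjoin_field] by blast
  ultimately have sub: "field_closure (K \<union> {t}) \<subseteq> ?N" by (intro field_closure_least[OF N]) simp
  have "algebraic_over ?M x" if "x \<in> F" for x
  proof -
    have "x ^ q \<in> ?N" using F(4)[OF that] sub by (rule rev_subsetD)
    hence "algebraic_over ?N x" by (rule algebraic_over_power[OF subfieldE(1)[OF N] _ F(3)])
    thus ?thesis by (rule algebraic_over_trans[OF subfield_adjoin_field])
  qed
  thus "transcendence_basis \<iota> F (insert t D)"
    unfolding transcendence_basis_def
    using alg_independent_insert[OF \<iota> _ t'] D' F(1,2) by blast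
qed

section \<open>Affine models and rational maps\<close>

lemma field_closure_Un_field_closure:
  "field_closure (field_closure H \<union> Z) = field_closure (H \<union> Z)"
proof (rule field_closure_eqI)
  show "field_closure H \<union> Z \<subseteq> field_closure (H \<union> Z)"
    using field_closure_mono[of H "H \<union> Z"] field_closure_superset[of "H \<union> Z"] by blast
  show "H \<union> Z \<subseteq> field_closure (field_closure H \<union> Z)"
    using field_closure_superset[of H] field_closure_superset[of "field_closure H \<union> Z"] by blast
qed

lemma ring_closure_Un_ring_closure:
  "ring_closure (ring_closure H \<union> Z) = ring_closure (H \<union> Z)"
proof
  show "ring_closure (ring_closure H \<union> Z) \<subseteq> ring_closure (H \<union> Z)"
    by (rule ring_closure_least[OF subring_ring_closure])
      (use ring_closure_mono[of H "H \<union> Z"] ring_closure_superset[of "H \<union> Z"] in blast)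
  show "ring_closure (H \<union> Z) \<subseteq> ring_closure (ring_closure H \<union> Z)"
    using ring_closure_superset[of H] by (intro ring_closure_mono) blast
qed

lemma adjoin_ring_insert: "ring_closure (adjoin_ring \<iota> S \<union> Z) = adjoin_ring \<iota> (S \<union> Z)"
  unfolding adjoin_ring_def ring_closure_Un_ring_closure by (simp add: Un_assoc)

lemma coordinate_ring_subring: "coordinate_ring \<iota> F A \<Longrightarrow> subring A ambient"
  by (auto simp: coordinate_ring_def subring_adjoin_ring)

lemma coordinate_ring_adjoin_ring:
  "finite S \<Longrightarrow> coordinate_ring \<iota> (adjoin_field \<iota> S) (adjoin_ring \<iota> S)"
  by (auto simp: coordinate_ring_def adjoin_field_fraction_field)

text \<open>
  Only separatedness needs an argument.  If a local ring \<open>Q\<close> dominates the localization of \<open>A\<close> at \<open>P\<close>,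
  then \<open>P\<close> consists of the elements of \<open>A\<close> that are not invertible in \<open>Q\<close>, so \<open>Q\<close> determines \<open>P\<close>.
\<close>

lemma is_variety_spec_points:
  assumes \<iota>: "field_embedding \<iota>" and "coordinate_ring \<iota> F A"
  shows "is_variety \<iota> (spec_points A)"
  unfolding is_variety_def
proof (intro conjI ballI allI impI)
  have A: "subring A ambient" by (rule coordinate_ring_subring[OF assms(2)])
  have F: "function_field (spec_points A) = F"
    unfolding function_field_def Union_spec_points[OF A] using assms(2) by (simp add: coordinate_ring_def)
  show "\<exists>\<A>. finite \<A> \<and> \<A> \<noteq> {} \<and> (\<forall>A'\<in>\<A>. coordinate_ring \<iota> (function_field (spec_points A)) A') \<and>
     spec_points A = (\<Union>A'\<in>\<A>. spec_points A')"
    using assms(2) by (intro exI[of _ "{A}"]) (simp add: F)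
  fix R S Q
  assume R: "R \<in> spec_points A" and S: "S \<in> spec_points A" and QR: "dominates Q R" and QS: "dominates Q S"
  have centre: "P = A \<inter> nonunits Q" if P: "primeideal P (as_ring A)" "dominates Q (localization A P)" for P
  proof -
    note P' = P(1)[unfolded primeideal_as_ring_iff[OF A]]
    have "x \<in> nonunits Q \<longleftrightarrow> x \<in> P" if x: "x \<in> A" for x
    proof
      assume "x \<in> P"
      hence "x / 1 \<in> nonunits (localization A P)"
        using localization_nonunits_iff[OF A P(1) x, of 1] P' subring_rules(1)[OF A] by blast
      thus "x \<in> nonunits Q" using P(2) by (auto simp: dominates_def)
    next
      assume nu: "x \<in> nonunits Q"
      show "x \<in> P"
      proof (rule ccontr)
        assume "x \<notin> P"
        hence "x \<noteq> 0" using P' by metis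
        have "1 / x \<in> localization A P"
          unfolding localization_def using \<open>x \<notin> P\<close> x subring_rules(1)[OF A] by blast
        hence "1 / x \<in> Q" using P(2) unfolding dominates_def by blast
        moreover have "x * (1 / x) = 1" using \<open>x \<noteq> 0\<close> by simp
        ultimately show False using nu unfolding nonunits_iff by blast
      qed
    qed
    thus ?thesis using P' by blast
  qed
  obtain P P' where "R = localization A P" "primeideal P (as_ring A)"
    "S = localization A P'" "primeideal P' (as_ring A)"
    using R S unfolding spec_points_def by blast
  thus "R = S" using centre QR QS by metis
qed (rule \<iota>)

text \<open>
  The principal open subset on which \<open>h\<close> does not vanish: a prime \<open>P\<close> of \<open>A[1/h]\<close> and its contraction
  to \<open>A\<close> have the same localization, since fractions may be extended by powers of \<open>h\<close>.
\<close>

lemma spec_points_inverse_subset: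
  assumes A: "subring A (ambient :: 'a::field ring)" and h: "h \<in> A" "h \<noteq> 0"
  shows "spec_points (ring_closure (A \<union> {inverse h})) \<subseteq> spec_points A"
proof
  let ?A = "ring_closure (A \<union> {inverse h})"
  note rules = subring_rules[OF A]
  have Ah: "subring ?A ambient" by (rule subring_ring_closure)
  have sub: "A \<subseteq> ?A" "inverse h \<in> ?A" using ring_closure_superset[of "A \<union> {inverse h}"] by auto
  \<comment> \<open>Every element of \<open>A[1/h]\<close> is brought into \<open>A\<close> by a power of \<open>h\<close>.\<close>
  have "subring {x. \<exists>n. h ^ n * x \<in> A} ambient"
    unfolding subring_ambient_iff
  proof (intro conjI ballI)
    show "1 \<in> {x. \<exists>n. h ^ n * x \<in> A}" using rules(1) by (auto intro: exI[of _ 0])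
    fix x assume "x \<in> {x. \<exists>n. h ^ n * x \<in> A}"
    then obtain n where n: "h ^ n * x \<in> A" by blast
    show "- x \<in> {x. \<exists>n. h ^ n * x \<in> A}" using rules(3)[OF n] by auto
    fix y assume "y \<in> {x. \<exists>n. h ^ n * x \<in> A}"
    then obtain m where m: "h ^ m * y \<in> A" by blast
    have "h ^ m * (h ^ n * x) + h ^ n * (h ^ m * y) \<in> A" by (intro rules(4,6,7) n m h(1))
    moreover have "h ^ m * (h ^ n * x) + h ^ n * (h ^ m * y) = h ^ (n + m) * (x + y)"
      by (simp add: power_add algebra_simps)
    ultimately show "x + y \<in> {x. \<exists>n. h ^ n * x \<in> A}" unfolding mem_Collect_eq by metis
    have "(h ^ n * x) * (h ^ m * y) \<in> A" by (rule rules(6)[OF n m])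
    moreover have "(h ^ n * x) * (h ^ m * y) = h ^ (n + m) * (x * y)"
      by (simp add: power_add algebra_simps)
    ultimately show "x * y \<in> {x. \<exists>n. h ^ n * x \<in> A}" unfolding mem_Collect_eq by metis
  qed
  moreover have "A \<union> {inverse h} \<subseteq> {x. \<exists>n. h ^ n * x \<in> A}"
  proof -
    have "h ^ 0 * x \<in> A" if "x \<in> A" for x using that by simp
    moreover have "h ^ 1 * inverse h \<in> A" using h rules(1) by simp
    ultimately show ?thesis by blast
  qed
  ultimately have num: "\<exists>n. h ^ n * x \<in> A" if "x \<in> ?A" for x
    using ring_closure_least that by blast
  fix R assume "R \<in> spec_points ?A"
  then obtain P where R: "R = localization ?A P" and P: "primeideal P (as_ring ?A)"
    unfolding spec_points_def by blast
  note P' = P[unfolded primeideal_as_ring_iff[OF Ah]]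
  have "primeideal (P \<inter> A) (as_ring A)"
    unfolding primeideal_as_ring_iff[OF A]
  proof (intro conjI ballI impI)
    show "P \<inter> A \<subseteq> A" "0 \<in> P \<inter> A" "1 \<notin> P \<inter> A" using P' rules(2) by simp_all
    show "x + y \<in> P \<inter> A" if "x \<in> P \<inter> A" "y \<in> P \<inter> A" for x y
      using that P' rules(4)[of x y] by simp
    show "a * x \<in> P \<inter> A" if "a \<in> A" "x \<in> P \<inter> A" for a x
    proof -
      have "a \<in> ?A" using that(1) sub(1) by blast
      thus ?thesis using that P' rules(6)[of a x] by simp
    qed
    show "a \<in> P \<inter> A \<or> b \<in> P \<inter> A" if "a \<in> A" "b \<in> A" "a * b \<in> P \<inter> A" for a b
    proof -
      have "a \<in> ?A" "b \<in> ?A" using that(1,2) sub(1) by blast+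
      thus ?thesis using that P' by simp
    qed
  qed
  moreover have "localization ?A P = localization A (P \<inter> A)"
  proof
    show "localization A (P \<inter> A) \<subseteq> localization ?A P"
      unfolding localization_def using sub(1) by blast
    show "localization ?A P \<subseteq> localization A (P \<inter> A)"
    proof
      fix x assume "x \<in> localization ?A P"
      then obtain a s where x: "x = a / s" "a \<in> ?A" "s \<in> ?A" "s \<notin> P" by (auto simp: localization_def)
      obtain n m where n: "h ^ n * a \<in> A" and m: "h ^ m * s \<in> A" using num x by blast
      have "h ^ m * (h ^ n * a) \<in> A" "h ^ n * (h ^ m * s) \<in> A"
        by (intro rules(6,7) n m h(1))+
      hence A': "h ^ (n + m) * a \<in> A" "h ^ (n + m) * s \<in> A" by (simp_all add: power_add mult_ac)
      have "h ^ (n + m) * s \<notin> P"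
      proof
        assume "h ^ (n + m) * s \<in> P"
        hence "inverse h ^ (n + m) * (h ^ (n + m) * s) \<in> P"
          using P' subring_rules(7)[OF Ah sub(2)] by blast
        moreover have "inverse h ^ (n + m) * (h ^ (n + m) * s) = s"
          using h by (simp add: power_inverse)
        ultimately show False using x by simp
      qed
      moreover have "x = (h ^ (n + m) * a) / (h ^ (n + m) * s)" using x h by simp
      ultimately show "x \<in> localization A (P \<inter> A)" unfolding localization_def using A' by blast
    qed
  qed
  ultimately show "R \<in> spec_points A" unfolding R spec_points_def by blast
qed

text \<open>
  The point below the localization at \<open>P\<close> is the localization at the contraction of \<open>P\<close> along \<open>\<psi>\<close>.
\<close>

lemma dominates_contraction:
  assumes \<psi>: "field_embedding \<psi>" and A: "subring A ambient" and A': "subring A' ambient"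
    and sub: "\<psi> ` A \<subseteq> A'" and "R \<in> spec_points A'"
  shows "\<exists>S\<in>spec_points A. dominates R (\<psi> ` S)"
proof -
  obtain P where R: "R = localization A' P" and P: "primeideal P (as_ring A')"
    using assms(5) unfolding spec_points_def by blast
  note P' = P[unfolded primeideal_as_ring_iff[OF A']]
  let ?P = "A \<inter> \<psi> -` P"
  note emb = emb_0[OF \<psi>] emb_1[OF \<psi>] emb_add[OF \<psi>] emb_mult[OF \<psi>] emb_divide[OF \<psi>]
  have prime: "primeideal ?P (as_ring A)"
    unfolding primeideal_as_ring_iff[OF A] using P' subring_rules[OF A] sub
    by (auto simp: emb image_subset_iff)
  have "dominates R (\<psi> ` localization A ?P)"
    unfolding dominates_def
  proof (intro conjI subsetI)
    have frac: "\<exists>a s. y = \<psi> a / \<psi> s \<and> a \<in> A \<and> s \<in> A \<and> \<psi> s \<notin> P \<and> y = \<psi> (a / s)"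
      if y: "y \<in> \<psi> ` localization A ?P" for y
    proof -
      obtain a s where "y = \<psi> (a / s)" "a \<in> A" "s \<in> A" "s \<notin> ?P"
        using y unfolding localization_def by blast
      thus ?thesis by (intro exI[of _ a] exI[of _ s]) (simp add: emb)
    qed
    fix y
    {
      assume "y \<in> \<psi> ` localization A ?P"
      thus "y \<in> R" using frac[of y] sub unfolding R localization_def by blast
    next
      assume nu: "y \<in> nonunits (\<psi> ` localization A ?P)"
      then obtain a s where y: "y = \<psi> a / \<psi> s" "a \<in> A" "s \<in> A" "\<psi> s \<notin> P"
        using frac[of y] by (auto simp: nonunits_iff)
      have "\<psi> a \<in> P"
      proof (rule ccontr)
        assume "\<psi> a \<notin> P"
        hence "s / a \<in> localization A ?P" using y unfolding localization_def by blast
        moreover have "\<psi> a \<noteq> 0" "\<psi> s \<noteq> 0" using \<open>\<psi> a \<notin> P\<close> y P' by auto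
        hence "y * \<psi> (s / a) = 1" unfolding y by (simp add: emb)
        ultimately show False using nu unfolding nonunits_iff by blast
      qed
      thus "y \<in> nonunits R"
        unfolding R y using localization_nonunits_iff[OF A' P] y sub by blast
    }
  qed
  thus ?thesis using prime unfolding spec_points_def by blast
qed

text \<open>
  Choose an affine chart \<open>B\<close> of \<open>T\<close> and a common denominator \<open>h\<close> in \<open>A\<close> of the images of its finitely many
  generators.  Then \<open>\<psi>\<close> maps \<open>B\<close> into \<open>A[1/h]\<close>, and so defines a morphism on the open subset of \<open>V\<close>
  with coordinate ring \<open>A[1/h]\<close>.
\<close>

lemma dominant_rational_map_field_inclusion:
  assumes T: "is_variety \<iota> T" and A: "affine_open \<kappa> V A"
    and \<psi>: "field_embedding \<psi>" "\<psi> \<circ> \<iota> = \<kappa>" "\<psi> ` function_field T \<subseteq> function_field V"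
  shows "dominant_rational_map \<kappa> V \<iota> T \<psi>"
proof -
  obtain \<A> where "\<A> \<noteq> {}" "\<And>A. A \<in> \<A> \<Longrightarrow> coordinate_ring \<iota> (function_field T) A" "T = (\<Union>A\<in>\<A>. spec_points A)"
    using T unfolding is_variety_def by blast
  then obtain B where B: "coordinate_ring \<iota> (function_field T) B" "spec_points B \<subseteq> T" by blast
  then obtain S where S: "finite S" "B = adjoin_ring \<iota> S" by (auto simp: coordinate_ring_def)
  have FB: "fraction_field B = function_field T" using B by (simp add: coordinate_ring_def)
  obtain S' where S': "finite S'" "A = adjoin_ring \<kappa> S'" and FA: "fraction_field A = function_field V"
    and AV: "spec_points A \<subseteq> V"
    using A by (auto simp: affine_open_def coordinate_ring_def)
  have subA: "subring A ambient" unfolding S' by (rule subring_adjoin_ring)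
  have "S \<subseteq> function_field T"
    using adjoin_field_superset(2)[of S \<iota>] FB unfolding S adjoin_field_fraction_field by simp
  hence "\<psi> ` S \<subseteq> fraction_field A" unfolding FA using \<psi>(3) by blast
  then obtain h where h: "h \<in> A" "h \<noteq> 0" "\<And>x. x \<in> S \<Longrightarrow> h * \<psi> x \<in> A"
    using common_denominator[OF subA finite_imageI[OF S(1), of \<psi>]] by auto
  define D where "D = ring_closure (A \<union> {inverse h})"
  have subD: "subring D ambient" unfolding D_def by (rule subring_ring_closure)
  have AD: "A \<subseteq> D" "inverse h \<in> D" unfolding D_def using ring_closure_superset[of "A \<union> {inverse h}"] by auto
  have specD: "spec_points D \<subseteq> V"
    using spec_points_inverse_subset[OF subA h(1,2)] AV unfolding D_def by blast
  have FD: "fraction_field D = function_field V"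
  proof
    show "function_field V \<subseteq> fraction_field D" using AD unfolding FA[symmetric] fraction_field_def by blast
    show "fraction_field D \<subseteq> function_field V"
      using fraction_field_in_spec_points[OF subD] specD unfolding function_field_def by blast
  qed
  have "D = adjoin_ring \<kappa> (S' \<union> {inverse h})" unfolding D_def S' adjoin_ring_insert ..
  hence affD: "affine_open \<kappa> V D"
    unfolding affine_open_def coordinate_ring_def using S'(1) FD specD by blast
  have BD: "\<psi> ` B \<subseteq> D"
  proof -
    have "\<psi> x \<in> D" if "x \<in> S" for x
    proof -
      have "inverse h * (h * \<psi> x) \<in> D" using AD h(3)[OF that] subring_rules(6)[OF subD] by blast
      moreover have "inverse h * (h * \<psi> x) = \<psi> x" using h(2) by simp
      ultimately show ?thesis by simp
    qed
    moreover have "\<psi> (\<iota> c) \<in> D" for c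
    proof -
      have "\<psi> (\<iota> c) = \<kappa> c" using \<psi>(2) by (metis comp_apply)
      thus ?thesis
        using AD ring_closure_superset[of "range \<kappa> \<union> S'"] unfolding S' adjoin_ring_def by auto
    qed
    ultimately have "B \<subseteq> \<psi> -` D" unfolding S adjoin_ring_def
      by (intro ring_closure_least[OF emb_subring_vimage[OF \<psi>(1) subD]]) auto
    thus ?thesis by blast
  qed
  have "open_subvariety \<kappa> V (spec_points D)"
    unfolding open_subvariety_def using affD specD by blast
  moreover have "dominant_morphism \<kappa> (spec_points D) \<iota> T \<psi>"
    unfolding dominant_morphism_def
  proof (intro conjI ballI)
    show "\<psi> ` function_field T \<subseteq> function_field (spec_points D)"
      using \<psi>(3) unfolding function_field_def[of "spec_points D"] Union_spec_points[OF subD] FD .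
    fix R assume "R \<in> spec_points D"
    then obtain Q where "Q \<in> spec_points B" "dominates R (\<psi> ` Q)"
      using dominates_contraction[OF \<psi>(1) coordinate_ring_subring[OF B(1)] subD BD] by blast
    thus "\<exists>Q\<in>T. dominates R (\<psi> ` Q)" using B(2) by blast
  qed (rule \<psi>)+
  moreover have "spec_points D \<noteq> {}" using fraction_field_in_spec_points[OF subD] by blast
  ultimately show ?thesis unfolding dominant_rational_map_def by blast
qed

text \<open>
  Finiteness is automatic: the function field of \<open>V\<close> is finitely generated, and the generators are
  algebraic over the image of \<open>\<psi>\<close> because some power of each lies in it.
\<close>

lemma finite_purely_inseparable_mapI:
  fixes \<psi> :: "'t::field \<Rightarrow> 'a::field"
  assumes T: "is_variety \<iota> T" "function_field T = UNIV" and A: "affine_open \<kappa> V A"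
    and \<psi>: "field_embedding \<psi>" "\<psi> \<circ> \<iota> = \<kappa>" "range \<psi> \<subseteq> function_field V"
    and char: "CHAR('a) > 0" and pow: "\<And>x. x \<in> function_field V \<Longrightarrow> x ^ (CHAR('a) ^ n) \<in> range \<psi>"
  shows "finite_purely_inseparable_map \<kappa> V \<iota> T \<psi>"
proof -
  have sub\<psi>: "subfield (range \<psi>) ambient" by (rule emb_subfield[OF \<psi>(1) subfield_UNIV])
  obtain S where S: "finite S" "A = adjoin_ring \<kappa> S" and FA: "fraction_field A = function_field V"
    using A by (auto simp: affine_open_def coordinate_ring_def)
  have FV: "function_field V = adjoin_field \<kappa> S"
    using FA unfolding S adjoin_field_fraction_field by simp
  have "field_closure (range \<psi> \<union> S) = function_field V"
  proof
    show "field_closure (range \<psi> \<union> S) \<subseteq> function_field V"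
      unfolding FV by (rule field_closure_least[OF subfield_adjoin_field])
        (use \<psi>(3) adjoin_field_superset(2)[of S \<kappa>] FV in simp)
    have "range \<kappa> \<subseteq> range \<psi>" using \<psi>(2) by auto
    thus "function_field V \<subseteq> field_closure (range \<psi> \<union> S)"
      unfolding FV adjoin_field_def by (intro field_closure_mono) blast
  qed
  moreover have "ring.finite_dimension ambient (range \<psi>) (field_closure (range \<psi> \<union> S))"
  proof (rule finite_dimension_field_closure[OF sub\<psi> S(1)])
    fix x assume "x \<in> S"
    hence "x ^ (CHAR('a) ^ n) \<in> range \<psi>" using pow adjoin_field_superset(2)[of S \<kappa>] FV by blast
    thus "algebraic_over (range \<psi>) x"
      by (rule algebraic_over_power[OF subfieldE(1)[OF sub\<psi>]]) (use char in simp)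
  qed
  moreover have "dominant_rational_map \<kappa> V \<iota> T \<psi>"
    by (rule dominant_rational_map_field_inclusion[OF T(1) A \<psi>(1,2)]) (use \<psi>(3) in \<open>simp add: T(2)\<close>)
  ultimately show ?thesis
    unfolding finite_purely_inseparable_map_def purely_inseparable_def T(2)
    using \<psi>(3) pow by (auto intro!: exI[of _ n])
qed

lemma variety_function_field_generators:
  assumes "is_variety \<iota> V"
  obtains A S where "finite S" "A = adjoin_ring \<iota> S" "spec_points A \<subseteq> V" "fraction_field A \<in> V"
    "function_field V = adjoin_field \<iota> S" "fraction_field A = function_field V"
proof -
  obtain \<A> where "\<A> \<noteq> {}" "\<And>A. A \<in> \<A> \<Longrightarrow> coordinate_ring \<iota> (function_field V) A" "V = (\<Union>A\<in>\<A>. spec_points A)"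
    using assms unfolding is_variety_def by blast
  then obtain A where A: "coordinate_ring \<iota> (function_field V) A" "spec_points A \<subseteq> V" by blast
  then obtain S where S: "finite S" "A = adjoin_ring \<iota> S" by (auto simp: coordinate_ring_def)
  have FA: "fraction_field A = function_field V" using A by (simp add: coordinate_ring_def)
  show thesis
    by (rule that[OF S A(2)])
      (use FA fraction_field_in_spec_points[OF coordinate_ring_subring[OF A(1)]] A(2) S(2)
        in \<open>auto simp: adjoin_field_fraction_field\<close>)
qed

section \<open>Products with the projective line and projective spaces\<close>

lemma product_with_line_function_field:
  assumes A: "affine_open \<kappa> Y A" and t: "ring.transcendental ambient (function_field Y) t"
  defines "P \<equiv> (\<Union>A\<in>{A. affine_open \<kappa> Y A}.
            spec_points (ring_closure (A \<union> {t})) \<union> spec_points (ring_closure (A \<union> {inverse t})))"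
  shows "function_field P = field_closure (function_field Y \<union> {t})"
    and "affine_open \<kappa> P (ring_closure (A \<union> {t}))"
proof -
  let ?E = "field_closure (function_field Y \<union> {t})"
  have frac: "fraction_field (ring_closure (A \<union> {t})) = ?E"
    "fraction_field (ring_closure (A \<union> {inverse t})) = ?E"
    if "affine_open \<kappa> Y A" for A
  proof -
    have "fraction_field A = function_field Y" "subring A ambient"
      using that coordinate_ring_subring by (auto simp: affine_open_def coordinate_ring_def)
    hence FA: "field_closure A = function_field Y" using fraction_field_subring by blast
    show t: "fraction_field (ring_closure (A \<union> {t})) = ?E"
      unfolding fraction_field_ring_closure FA[symmetric] field_closure_Un_field_closure ..
    \<comment> \<open>The two charts of the line have the same function field, since \<open>t\<close> and \<open>1/t\<close> generate each other.\<close>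
    have "inverse x \<in> field_closure (A \<union> {x})" for x
      using subfield_field_closure[of "A \<union> {x}"] field_closure_superset[of "A \<union> {x}"]
      by (auto simp: subfield_ambient_iff)
    from this[of t] this[of "inverse t"]
    have "field_closure (A \<union> {inverse t}) = field_closure (A \<union> {t})"
      using field_closure_superset[of "A \<union> {t}"] field_closure_superset[of "A \<union> {inverse t}"]
      by (intro field_closure_eqI) auto
    thus "fraction_field (ring_closure (A \<union> {inverse t})) = ?E"
      using t unfolding fraction_field_ring_closure by simp
  qed
  have "function_field P = (\<Union>A\<in>{A. affine_open \<kappa> Y A}.
      \<Union> (spec_points (ring_closure (A \<union> {t}))) \<union> \<Union> (spec_points (ring_closure (A \<union> {inverse t}))))"
    unfolding function_field_def P_def by blast
  also have "\<dots> = (\<Union>A\<in>{A. affine_open \<kappa> Y A}. ?E)"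
    by (rule SUP_cong[OF refl]) (simp only: mem_Collect_eq Union_spec_points[OF subring_ring_closure] frac Un_absorb)
  finally show FP: "function_field P = ?E" using A by auto
  have "\<exists>S. finite S \<and> A = adjoin_ring \<kappa> S" using A by (auto simp: affine_open_def coordinate_ring_def)
  then obtain S where S: "finite S" "A = adjoin_ring \<kappa> S" by blast
  have "ring_closure (A \<union> {t}) = adjoin_ring \<kappa> (S \<union> {t})" unfolding S adjoin_ring_insert ..
  thus "affine_open \<kappa> P (ring_closure (A \<union> {t}))"
    unfolding affine_open_def coordinate_ring_def FP frac(1)[OF A]
    using S(1) A unfolding P_def by blast
qed

text \<open>
  On each chart \<open>x j = (x j / x i) / (x 0 / x i)\<close>, so all charts have the same function field.
\<close>

lemma projective_space_function_field:
  fixes \<kappa> :: "'k::field \<Rightarrow> 'a::field" and x :: "nat \<Rightarrow> 'a"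
  assumes x: "x 0 = 1" "\<And>i. i \<le> m \<Longrightarrow> x i \<noteq> 0"
  defines "V \<equiv> (\<Union>i\<in>{..m}. spec_points (adjoin_ring \<kappa> {x j / x i | j. j \<le> m}))"
  shows "function_field V = adjoin_field \<kappa> (x ` {1..m})"
    and "affine_open \<kappa> V (adjoin_ring \<kappa> {x j / x 0 | j. j \<le> m})"
proof -
  have chart: "adjoin_field \<kappa> {x j / x i | j. j \<le> m} = adjoin_field \<kappa> (x ` {1..m})" if i: "i \<le> m" for i
    unfolding adjoin_field_def
  proof (rule field_closure_eqI)
    let ?E = "field_closure (range \<kappa> \<union> x ` {1..m})"
    have E: "range \<kappa> \<subseteq> ?E" "x ` {1..m} \<subseteq> ?E"
      using field_closure_superset[of "range \<kappa> \<union> x ` {1..m}"] by simp_all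
    have xE: "x j \<in> ?E" if "j \<le> m" for j
    proof (cases "j = 0")
      case True
      thus ?thesis using x(1) subring_rules(1)[OF subring_field_closure] by simp
    next
      case False
      hence "x j \<in> x ` {1..m}" using that by (intro imageI) simp
      thus ?thesis using E(2) by (rule rev_subsetD)
    qed
    have "x j / x i \<in> ?E" if "j \<le> m" for j
      by (rule subfield_divide[OF subfield_field_closure xE[OF that] xE[OF i]])
    hence "{x j / x i | j. j \<le> m} \<subseteq> ?E" by (intro subsetI) (elim CollectE exE conjE, simp)
    thus "range \<kappa> \<union> {x j / x i | j. j \<le> m} \<subseteq> ?E" using E(1) by (rule Un_least[rotated])
    let ?F = "field_closure (range \<kappa> \<union> {x j / x i | j. j \<le> m})"
    have F: "range \<kappa> \<subseteq> ?F" "{x j / x i | j. j \<le> m} \<subseteq> ?F"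
      using field_closure_superset[of "range \<kappa> \<union> {x j / x i | j. j \<le> m}"] by simp_all
    have xF: "x j \<in> ?F" if "j \<le> m" for j
    proof -
      have "x j / x i \<in> ?F" "x 0 / x i \<in> ?F"
        by (rule subsetD[OF F(2)], rule CollectI, use that in blast)+
      hence "(x j / x i) / (x 0 / x i) \<in> ?F" by (rule subfield_divide[OF subfield_field_closure])
      thus ?thesis using x(1) x(2)[OF i] by simp
    qed
    have "x ` {1..m} \<subseteq> ?F" by (rule image_subsetI) (rule xF, simp)
    thus "range \<kappa> \<union> x ` {1..m} \<subseteq> ?F" using F(1) by (rule Un_least[rotated])
  qed
  have frac: "\<Union> (spec_points (adjoin_ring \<kappa> {x j / x i | j. j \<le> m})) = adjoin_field \<kappa> (x ` {1..m})"
    if "i \<le> m" for i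
    unfolding Union_spec_points[OF subring_adjoin_ring] adjoin_field_fraction_field[symmetric] by (rule chart[OF that])
  have "function_field V = (\<Union>i\<in>{..m}. \<Union> (spec_points (adjoin_ring \<kappa> {x j / x i | j. j \<le> m})))"
    unfolding function_field_def V_def by blast
  also have "\<dots> = (\<Union>i\<in>{..m}. adjoin_field \<kappa> (x ` {1..m}))"
    by (rule SUP_cong) (use frac in auto)
  finally show FV: "function_field V = adjoin_field \<kappa> (x ` {1..m})" by simp
  have "finite {x j / x 0 | j. j \<le> m}" by simp
  hence "coordinate_ring \<kappa> (adjoin_field \<kappa> {x j / x 0 | j. j \<le> m}) (adjoin_ring \<kappa> {x j / x 0 | j. j \<le> m})"
    by (rule coordinate_ring_adjoin_ring)
  thus "affine_open \<kappa> V (adjoin_ring \<kappa> {x j / x 0 | j. j \<le> m})"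
    unfolding affine_open_def FV chart[OF le0] unfolding V_def by blast
qed

section \<open>Uniruledness and unirationality in terms of function fields\<close>

text \<open>
  The generators in \<open>S\<close> define the affine variety \<open>Y\<close>, \<open>t\<close> is the coordinate on the line, and
  \<open>D\<close> measures the dimension of \<open>Y\<close>.
\<close>

lemma uniruledI:
  fixes \<iota>T :: "'k::field \<Rightarrow> 't::field" and \<psi> :: "'t \<Rightarrow> 't alg_closure"
  assumes T: "is_variety \<iota>T T" "function_field T = UNIV"
    and \<psi>: "field_embedding \<psi>" "\<psi> \<circ> \<iota>T = \<kappa>"
    and S: "finite S" and D: "finite D" "transcendence_basis \<kappa> (adjoin_field \<kappa> S) D"
    and dim: "variety_dim \<iota>T T = card D + 1"
    and t: "ring.transcendental ambient (adjoin_field \<kappa> S) t"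
    and range: "range \<psi> \<subseteq> field_closure (adjoin_field \<kappa> S \<union> {t})"
    and char: "CHAR('t alg_closure) > 0"
    and pow: "\<And>x. x \<in> field_closure (adjoin_field \<kappa> S \<union> {t}) \<Longrightarrow> x ^ (CHAR('t alg_closure) ^ n) \<in> range \<psi>"
  shows "uniruled \<iota>T T"
proof -
  have \<iota>T: "field_embedding \<iota>T" using T(1) by (simp add: is_variety_def)
  have \<kappa>: "field_embedding \<kappa>" using field_embedding_comp[OF \<iota>T \<psi>(1)] \<psi>(2) by simp
  define Y where "Y = spec_points (adjoin_ring \<kappa> S)"
  have FY: "function_field Y = adjoin_field \<kappa> S"
    unfolding function_field_def Y_def Union_spec_points[OF subring_adjoin_ring] adjoin_field_fraction_field ..
  have Y: "is_variety \<kappa> Y"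
    unfolding Y_def by (rule is_variety_spec_points[OF \<kappa> coordinate_ring_adjoin_ring[OF S]])
  have affY: "affine_open \<kappa> Y (adjoin_ring \<kappa> S)"
    unfolding affine_open_def FY using coordinate_ring_adjoin_ring[OF S] by (simp add: Y_def)
  have dimY: "variety_dim \<kappa> Y = card D"
    by (rule variety_dim_eq_card[OF \<kappa> D(1)]) (simp add: FY D(2))
  define P where "P = (\<Union>A\<in>{A. affine_open \<kappa> Y A}.
      spec_points (ring_closure (A \<union> {t})) \<union> spec_points (ring_closure (A \<union> {inverse t})))"
  have t': "ring.transcendental ambient (function_field Y) t" using t by (simp add: FY)
  note P = product_with_line_function_field[OF affY t', folded P_def]
  have "product_with_line \<kappa> Y P" unfolding product_with_line_def P_def using t' by blast
  moreover have "finite_purely_inseparable_map \<kappa> P \<iota>T T \<psi>"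
    by (rule finite_purely_inseparable_mapI[OF T P(2) \<psi> _ char]) (use range pow in \<open>simp_all add: P(1) FY\<close>)
  ultimately show ?thesis unfolding uniruled_def using Y dimY dim by metis
qed

text \<open>
  The independent generators in \<open>S\<close> are numbered to serve as the inhomogeneous coordinates of a
  projective space.
\<close>

lemma unirationalI:
  fixes \<iota>T :: "'k::field \<Rightarrow> 't::field" and \<psi> :: "'t \<Rightarrow> 't alg_closure"
  assumes T: "is_variety \<iota>T T" "function_field T = UNIV"
    and \<psi>: "field_embedding \<psi>" "\<psi> \<circ> \<iota>T = \<kappa>"
    and S: "finite S" "alg_independent \<kappa> S" "variety_dim \<iota>T T = card S"
    and range: "range \<psi> \<subseteq> adjoin_field \<kappa> S"
    and char: "CHAR('t alg_closure) > 0"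
    and pow: "\<And>x. x \<in> adjoin_field \<kappa> S \<Longrightarrow> x ^ (CHAR('t alg_closure) ^ n) \<in> range \<psi>"
  shows "unirational \<iota>T T"
proof -
  have \<iota>T: "field_embedding \<iota>T" using T(1) by (simp add: is_variety_def)
  have \<kappa>: "field_embedding \<kappa>" using field_embedding_comp[OF \<iota>T \<psi>(1)] \<psi>(2) by simp
  define m where "m = card S"
  obtain g where g: "bij_betw g {1..m} S"
    using ex_bij_betw_nat_finite_1[OF S(1)] unfolding m_def by blast
  define x where "x = (\<lambda>i. if i = 0 then 1 else g i)"
  have img: "x ` {1..m} = S"
  proof -
    have "x ` {1..m} = g ` {1..m}" by (rule image_cong) (auto simp: x_def)
    thus ?thesis using g by (simp add: bij_betw_def)
  qed
  have inj: "inj_on x {1..m}"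
  proof -
    have "inj_on x {1..m} = inj_on g {1..m}" by (rule inj_on_cong) (auto simp: x_def)
    thus ?thesis using g by (simp add: bij_betw_def)
  qed
  have x0: "x 0 = 1" by (simp add: x_def)
  have nz: "x i \<noteq> 0" if "i \<le> m" for i
  proof (cases "i = 0")
    case False
    hence "x i \<in> S" using that img by (metis One_nat_def Suc_leI atLeastAtMost_iff gr0I image_eqI)
    thus ?thesis using alg_independent_nonzero[OF \<kappa> S(2)] by metis
  qed (simp add: x0)
  define V where "V = (\<Union>i\<in>{..m}. spec_points (adjoin_ring \<kappa> {x j / x i | j. j \<le> m}))"
  have V: "function_field V = adjoin_field \<kappa> S" "affine_open \<kappa> V (adjoin_ring \<kappa> {x j / x 0 | j. j \<le> m})"
    unfolding img[symmetric] V_def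
    by (rule projective_space_function_field[where x = x and m = m, OF x0 nz], assumption)+
  have "projective_space \<kappa> m V"
    unfolding projective_space_def V_def using \<kappa> x0 inj img S(2) by blast
  moreover have "finite_purely_inseparable_map \<kappa> V \<iota>T T \<psi>"
    by (rule finite_purely_inseparable_mapI[OF T V(2) \<psi> _ char]) (use range pow in \<open>simp_all add: V(1)\<close>)
  ultimately show ?thesis unfolding unirational_def S(3) m_def[symmetric] by blast
qed

section \<open>Extraction of roots along Frobenius\<close>

definition frobenius_root :: "nat \<Rightarrow> 'a::field \<Rightarrow> 'a alg_closure" where
  "frobenius_root q x = (SOME y. y ^ q = to_ac x)"

context
  fixes q n :: nat
  assumes char: "CHAR('a::field) > 0" and q: "q = CHAR('a) ^ n"
begin

lemma q_pos: "q > 0"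
  using char q by simp

lemma char_alg_closure: "CHAR('a alg_closure) = CHAR('a)"
  by (rule emb_char[OF field_embedding_to_ac])

lemma power_q_add: "(x + y :: 'a alg_closure) ^ q = x ^ q + y ^ q"
  by (rule freshmans_dream'[where n = n])
    (use prime_CHAR_semidom[where ?'a = 'a, OF char] in \<open>simp_all add: char_alg_closure q\<close>)

lemma power_q_inj: "(x :: 'a alg_closure) ^ q = y ^ q \<Longrightarrow> x = y"
  using power_q_add[of "x - y" y] q_pos by simp

lemma frobenius_root_power: "frobenius_root q (x :: 'a) ^ q = to_ac x"
proof -
  have "\<exists>y. y ^ q = to_ac x" using nth_root_exists[OF q_pos, of "to_ac x"] by blast
  thus ?thesis unfolding frobenius_root_def by (rule someI_ex)
qed

lemma frobenius_root_eqI: "y ^ q = to_ac (x :: 'a) \<Longrightarrow> frobenius_root q x = y"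
  by (rule power_q_inj) (simp add: frobenius_root_power)

text \<open>
  In characteristic \<open>p\<close> the map \<open>y \<mapsto> y\<^sup>q\<close> is additive and injective, so a \<open>q\<close>-th root is determined by
  its defining equation, and roots of sums and products are sums and products of roots.
\<close>

lemma field_embedding_frobenius_root: "field_embedding (frobenius_root q :: 'a \<Rightarrow> 'a alg_closure)"
  unfolding field_embedding_iff
  by (auto intro!: frobenius_root_eqI simp: power_q_add power_mult_distrib frobenius_root_power)

lemma to_ac_eq_frobenius_root: "to_ac x = frobenius_root q (x ^ q :: 'a)"
  by (rule frobenius_root_eqI[symmetric]) simp

end

section \<open>Rational Frobenius pullbacks\<close>

text \<open>
  The generic point of \<open>T\<close>, which is \<open>F\<close> itself, lies in the generic fibre, and its pullback \<open>F\<^sup>q \<cdot> K\<close>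
  contains all \<open>q\<close>-th powers.
\<close>

lemma frobenius_pullback_powers:
  assumes T: "is_variety \<iota> T" "function_field T = UNIV"
    and \<phi>: "field_embedding \<phi>" "function_field B = UNIV"
  shows "x ^ q \<in> function_field (frobenius_pullback \<phi> q (generic_fibre T B \<phi>))"
proof -
  have K: "subfield (range \<phi>) ambient" by (rule emb_subfield[OF \<phi>(1) subfield_UNIV])
  have "UNIV \<in> T" using variety_function_field_generators[OF T(1)] T(2) by metis
  moreover have "dominates UNIV (range \<phi>)"
    unfolding dominates_def
  proof (intro conjI subsetI)
    fix y assume y: "y \<in> nonunits (range \<phi>)"
    have "y = 0"
    proof (rule ccontr)
      assume "y \<noteq> 0"
      hence "y * inverse y = 1" by simp
      moreover have "inverse y \<in> range \<phi>" using y K unfolding subfield_ambient_iff nonunits_iff by blast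
      ultimately show False using y unfolding nonunits_iff by blast
    qed
    thus "y \<in> nonunits UNIV" by (simp add: nonunits_iff)
  qed simp
  ultimately have "UNIV \<in> generic_fibre T B \<phi>" by (simp add: generic_fibre_def \<phi>(2))
  moreover have "x ^ q \<in> adjoin_ring \<phi> ((\<lambda>r. r ^ q) ` UNIV)"
    unfolding adjoin_ring_def using ring_closure_superset[of "range \<phi> \<union> (\<lambda>r. r ^ q) ` UNIV"] by blast
  ultimately show ?thesis unfolding function_field_def frobenius_pullback_def by blast
qed

theorem proposition4p2:
  fixes \<iota>T :: "'k::alg_closed_field \<Rightarrow> 't::field"
    and \<iota>B :: "'k \<Rightarrow> 'b::field"
    and T :: "'t set set" and B :: "'b set set"
    and \<phi> :: "'b \<Rightarrow> 't"
    and p n :: nat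
  assumes char: "CHAR('k) = p" "p > 0"
    and T: "is_variety \<iota>T T" "function_field T = UNIV"
    and B: "is_variety \<iota>B B" "function_field B = UNIV"
    and fibration: "dominant_morphism \<iota>T T \<iota>B B \<phi>"
    and curve: "is_curve \<phi> (generic_fibre T B \<phi>)"
      "is_regular (generic_fibre T B \<phi>)"
      "geometrically_integral \<phi> (generic_fibre T B \<phi>)"
    and rational: "is_rational \<phi> 1 (frobenius_pullback \<phi> (p ^ n) (generic_fibre T B \<phi>))"
  shows "uniruled \<iota>T T \<and> (is_rational \<iota>B (variety_dim \<iota>B B) B \<longrightarrow> unirational \<iota>T T)"
proof -
  have \<iota>T: "field_embedding \<iota>T" and \<iota>B: "field_embedding \<iota>B"
    using T(1) B(1) by (simp_all add: is_variety_def)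
  have \<phi>: "field_embedding \<phi>" and \<phi>\<iota>: "\<phi> \<circ> \<iota>B = \<iota>T"
    using fibration by (simp_all add: dominant_morphism_def)
  define q where "q = p ^ n"
  have charT: "CHAR('t) = p" using emb_char[OF \<iota>T] char by simp
  have charT_pos: "CHAR('t) > 0" and qT: "q = CHAR('t) ^ n" using charT char by (simp_all add: q_def)
  have q_pos: "q > 0" using char by (simp add: q_def)
  have char_closure: "CHAR('t alg_closure) = p" using emb_char[OF field_embedding_to_ac, where ?'a = 't] charT by simp
  obtain s where s: "alg_independent \<phi> {s}"
    and pullback: "function_field (frobenius_pullback \<phi> q (generic_fibre T B \<phi>)) = adjoin_field \<phi> {s}"
    using rational unfolding is_rational_def q_def by (metis card_1_singletonE)
  let ?K = "range \<phi>"
  have K: "subfield ?K ambient" by (rule emb_subfield[OF \<phi> subfield_UNIV])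
  have pow: "x ^ q \<in> field_closure (?K \<union> {s})" for x
    using frobenius_pullback_powers[OF T \<phi> B(2), of x q] unfolding pullback adjoin_field_def by simp
  have s: "ring.transcendental ambient ?K s"
    by (rule alg_independent_singleton_imp_transcendental[OF \<phi> s])

  define G where "G = (frobenius_root q :: 't \<Rightarrow> 't alg_closure)"
  note G = field_embedding_frobenius_root[OF charT_pos qT, folded G_def]
    and G_power = frobenius_root_power[OF charT_pos qT, folded G_def]
    and G_eqI = frobenius_root_eqI[OF charT_pos qT, folded G_def]
    and to_ac_G = to_ac_eq_frobenius_root[OF charT_pos qT, folded G_def]
  define \<psi> where "\<psi> = (to_ac :: 't \<Rightarrow> 't alg_closure)"
  define \<kappa> where "\<kappa> = \<psi> \<circ> \<iota>T"
  have \<psi>: "field_embedding \<psi>" unfolding \<psi>_def by (rule field_embedding_to_ac)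
  have \<kappa>: "field_embedding \<kappa>" unfolding \<kappa>_def by (rule field_embedding_comp[OF \<iota>T \<psi>])
  \<comment> \<open>This is where perfectness of \<open>k\<close> enters: every element of \<open>k\<close> has a \<open>q\<close>-th root in \<open>k\<close>.\<close>
  have G\<iota>: "G ` range \<iota>T = range \<kappa>"
  proof
    show "range \<kappa> \<subseteq> G ` range \<iota>T"
    proof
      fix y assume "y \<in> range \<kappa>"
      then obtain c where "y = to_ac (\<iota>T c)" by (auto simp: \<kappa>_def \<psi>_def)
      hence "y = G (\<iota>T (c ^ q))" using to_ac_G emb_power[OF \<iota>T] by simp
      thus "y \<in> G ` range \<iota>T" by blast
    qed
    show "G ` range \<iota>T \<subseteq> range \<kappa>"
    proof
      fix y assume "y \<in> G ` range \<iota>T"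
      then obtain c where y: "y = G (\<iota>T c)" by blast
      obtain d where d: "d ^ q = c" using nth_root_exists[OF q_pos] by blast
      have "y = \<kappa> d"
        unfolding y d[symmetric] emb_power[OF \<iota>T] to_ac_G[symmetric] by (simp add: \<kappa>_def \<psi>_def)
      thus "y \<in> range \<kappa>" by blast
    qed
  qed
  define \<theta> where "\<theta> = G \<circ> \<phi>"
  have \<theta>: "field_embedding \<theta>" unfolding \<theta>_def by (rule field_embedding_comp[OF \<phi> G])
  have \<phi>range: "\<phi> ` range \<iota>B = range \<iota>T" using \<phi>\<iota> by (metis image_comp)
  have \<theta>range: "\<theta> ` range \<iota>B = range \<kappa>"
    unfolding \<theta>_def image_comp[symmetric] \<phi>range G\<iota> ..
  \<comment> \<open>The range of \<open>\<theta>\<close> is \<open>K\<^bsup>1/q\<^esup>\<close>, so this is the field \<open>K(s)\<^bsup>1/q\<^esup>\<close>.\<close>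
  let ?E = "field_closure (range \<theta> \<union> {G s})"
  have E: "?E = G ` field_closure (?K \<union> {s})"
    unfolding emb_field_closure[OF G] image_Un \<theta>_def image_comp[symmetric] by simp
  have \<psi>E: "range \<psi> \<subseteq> ?E"
    unfolding E \<psi>_def using to_ac_G pow by auto
  have E_pow: "x ^ (CHAR('t alg_closure) ^ n) \<in> range \<psi>" if "x \<in> ?E" for x
    using that unfolding E \<psi>_def char_closure q_def[symmetric] by (auto simp: G_power)
  have char_pos: "CHAR('t alg_closure) > 0" using char char_closure by simp
  have t: "ring.transcendental ambient (range \<theta>) (G s)"
    using algebraic_over_emb_iff[OF G subfieldE(1)[OF K], of s] s unfolding \<theta>_def image_comp[symmetric] by blast

  \<comment> \<open>Every finite transcendence basis \<open>D\<close> of \<open>K\<close> yields bases of \<open>F\<close> and of \<open>K\<^bsup>1/q\<^esup>\<close>.\<close>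
  have basis: "transcendence_basis \<iota>T UNIV (insert s (\<phi> ` D))" "variety_dim \<iota>T T = card D + 1"
    "transcendence_basis \<kappa> (range \<theta>) (\<theta> ` D)" "card (\<theta> ` D) = card D" "variety_dim \<iota>B B = card D"
    if D: "finite D" "transcendence_basis \<iota>B UNIV D" for D
  proof -
    have K_basis: "transcendence_basis \<iota>T ?K (\<phi> ` D)"
      by (rule emb_transcendence_basis[OF \<phi> \<iota>B \<iota>T \<phi>range D])
    have "range \<iota>T \<subseteq> ?K" using \<phi>range by blast
    note ins = transcendence_basis_insert[OF \<iota>T K K_basis s this _ _ q_pos, of UNIV, simplified]
    show 1: "transcendence_basis \<iota>T UNIV (insert s (\<phi> ` D))" using ins(1) pow by simp
    have "s \<notin> \<phi> ` D" using ins(2) pow by simp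
    hence "card (insert s (\<phi> ` D)) = card D + 1"
      using D(1) card_image[OF inj_on_subset[OF emb_inj[OF \<phi>] subset_UNIV], of D] by simp
    thus "variety_dim \<iota>T T = card D + 1"
      using variety_dim_eq_card[OF \<iota>T, of "insert s (\<phi> ` D)" T] 1 D(1) T(2) by simp
    show "transcendence_basis \<kappa> (range \<theta>) (\<theta> ` D)"
      by (rule emb_transcendence_basis[OF \<theta> \<iota>B \<kappa> \<theta>range D])
    show "card (\<theta> ` D) = card D"
      by (rule card_image[OF inj_on_subset[OF emb_inj[OF \<theta>] subset_UNIV]])
    show "variety_dim \<iota>B B = card D"
      using variety_dim_eq_card[OF \<iota>B D(1), of B] D(2) B(2) by simp
  qed

  have "uniruled \<iota>T T"
  proof -
    obtain S where S: "finite S" "adjoin_field \<iota>B S = UNIV"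
      using variety_function_field_generators[OF B(1)] B(2) by metis
    obtain D where "D \<subseteq> S" "transcendence_basis \<iota>B UNIV D"
      using ex_transcendence_basis[OF \<iota>B S(1)] S(2) by auto
    hence D: "finite D" "transcendence_basis \<iota>B UNIV D" using S(1) finite_subset by auto
    have F: "adjoin_field \<kappa> (\<theta> ` S) = range \<theta>"
      using emb_adjoin_field[OF \<theta> \<theta>range, of S] S(2) by simp
    show ?thesis
    proof (rule uniruledI[OF T \<psi> \<kappa>_def[symmetric], where S = "\<theta> ` S" and D = "\<theta> ` D" and t = "G s" and n = n])
      show "finite (\<theta> ` S)" "finite (\<theta> ` D)" using S(1) D(1) by simp_all
      show "transcendence_basis \<kappa> (adjoin_field \<kappa> (\<theta> ` S)) (\<theta> ` D)" unfolding F by (rule basis(3)[OF D])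
      show "variety_dim \<iota>T T = card (\<theta> ` D) + 1" using basis(2,4)[OF D] by simp
      show "ring.transcendental ambient (adjoin_field \<kappa> (\<theta> ` S)) (G s)" unfolding F by (rule t)
      show "range \<psi> \<subseteq> field_closure (adjoin_field \<kappa> (\<theta> ` S) \<union> {G s})" unfolding F by (rule \<psi>E)
      show "x ^ (CHAR('t alg_closure) ^ n) \<in> range \<psi>"
        if "x \<in> field_closure (adjoin_field \<kappa> (\<theta> ` S) \<union> {G s})" for x
        using that unfolding F by (rule E_pow)
    qed (rule char_pos)
  qed
  moreover have "unirational \<iota>T T" if ratB: "is_rational \<iota>B (variety_dim \<iota>B B) B"
  proof -
    obtain D where D: "finite D" "alg_independent \<iota>B D" "adjoin_field \<iota>B D = UNIV"
      using ratB B(2) unfolding is_rational_def by auto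
    have tb: "transcendence_basis \<iota>B UNIV D"
      using transcendence_basis_adjoin_field[OF D(2)] D(3) by simp
    let ?D = "insert s (\<phi> ` D)"
    note basisD = basis[OF D(1) tb]
    have ind: "alg_independent \<iota>T ?D" using basisD(1) unfolding transcendence_basis_def by blast
    have GD: "G ` ?D = \<theta> ` D \<union> {G s}" by (auto simp: \<theta>_def)
    have "adjoin_field \<kappa> (G ` ?D) = field_closure (field_closure (range \<kappa> \<union> \<theta> ` D) \<union> {G s})"
      unfolding field_closure_Un_field_closure adjoin_field_def GD by (simp add: Un_assoc)
    also have "field_closure (range \<kappa> \<union> \<theta> ` D) = range \<theta>"
      using emb_adjoin_field[OF \<theta> \<theta>range, of D] D(3) by (simp add: adjoin_field_def)
    finally have F: "adjoin_field \<kappa> (G ` ?D) = ?E" .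
    show ?thesis
    proof (rule unirationalI[OF T \<psi> \<kappa>_def[symmetric], where S = "G ` ?D" and n = n])
      show "finite (G ` ?D)" using D(1) by simp
      show "alg_independent \<kappa> (G ` ?D)"
        by (rule emb_alg_independent[OF G \<iota>T \<kappa> G\<iota> _ ind]) (use D(1) in simp)
      have "variety_dim \<iota>T T = card ?D"
        by (rule variety_dim_eq_card[OF \<iota>T]) (use D(1) basisD(1) T(2) in simp_all)
      also have "\<dots> = card (G ` ?D)"
        by (rule card_image[OF inj_on_subset[OF emb_inj[OF G] subset_UNIV], symmetric])
      finally show "variety_dim \<iota>T T = card (G ` ?D)" .
      show "range \<psi> \<subseteq> adjoin_field \<kappa> (G ` ?D)" unfolding F by (rule \<psi>E)
      show "x ^ (CHAR('t alg_closure) ^ n) \<in> range \<psi>" if "x \<in> adjoin_field \<kappa> (G ` ?D)" for x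
        using that unfolding F by (rule E_pow)
    qed (rule char_pos)
  qed
  ultimately show ?thesis by blast
qed

end
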